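(* Let $d\ge 1$ and let $1<p,q,r<\infty$ satisfy $\frac1p+\frac1q+\frac1r=2$. Then for every $k\in L_q(\mathbb{R}^d)$ there exists a maximizer of the convolution operator $K:f\mapsto k*f$ with respect to the pair of exponents $(p,r)$; that is, there exists $f\in L_p(\mathbb{R}^d)$ with $\|f\|_p=1$ and $\|k*f\|_{r'}=\|K\|_{p,r}$.
   Context: All functions are complex-valued and measurable; $L_p=L_p(\mathbb{R}^d)$ is the Lebesgue space with its usual norm $\|\cdot\|_p$. The conjugate exponent is $r'=(1-1/r)^{-1}$. The convolution is $(k*f)(x)=\int_{\mathbb{R}^d}k(x-y)f(y)\,dy$. By Young's inequality $K$ is bounded from $L_p$ to $L_{r'}$, and $\|K\|_{p,r}=\sup\{\|k*f\|_{r'}:\|f\|_p=1\}$ denotes its operator norm from $L_p$ to $L_{r'}$. *)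

theory Defs
  imports "HOL-Analysis.Analysis"
begin

text \<open>
  Functions are used instead of classes modulo null sets, and ``measurable'' means Lebesgue
  measurable. The norm takes the value \<open>\<infinity>\<close> on measurable functions outside \<open>L\<^sub>p\<close>, so that
  suprema of norms are taken in a complete lattice.
\<close>

definition Lp_norm :: "real \<Rightarrow> ('a::euclidean_space \<Rightarrow> complex) \<Rightarrow> ennreal" where
  "Lp_norm p f =
    (let I = \<integral>\<^sup>+ x. ennreal (norm (f x) powr p) \<partial>lebesgue
     in if I = \<infinity> then \<infinity> else ennreal (enn2real I powr (1 / p)))"

definition Lp_space :: "real \<Rightarrow> ('a::euclidean_space \<Rightarrow> complex) set" where
  "Lp_space p = {f \<in> borel_measurable lebesgue. Lp_norm p f < \<infinity>}"

definition conj_exponent :: "real \<Rightarrow> real" where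
  "conj_exponent r = inverse (1 - 1 / r)"

text \<open>
  The Bochner integral is \<open>0\<close> at points where the integrand is not integrable. For
  \<open>k \<in> L\<^sub>q\<close> and \<open>f \<in> L\<^sub>p\<close> with exponents as in Young's inequality, these points form a null set.
\<close>

definition convolve ::
  "('a::euclidean_space \<Rightarrow> complex) \<Rightarrow> ('a \<Rightarrow> complex) \<Rightarrow> 'a \<Rightarrow> complex" where
  "convolve k f x = (\<integral>y. k (x - y) * f y \<partial>lebesgue)"

text \<open>The target space is \<open>L\<^bsub>r'\<^esub>\<close> with \<open>r'\<close> the exponent conjugate to the second index \<open>r\<close>.\<close>

definition op_norm ::
  "real \<Rightarrow> real \<Rightarrow> (('a::euclidean_space \<Rightarrow> complex) \<Rightarrow> 'a \<Rightarrow> complex) \<Rightarrow> ennreal" where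
  "op_norm p r K =
    (SUP f \<in> {f \<in> Lp_space p. Lp_norm p f = 1}. Lp_norm (conj_exponent r) (K f))"

definition is_maximizer ::
  "real \<Rightarrow> real \<Rightarrow> (('a::euclidean_space \<Rightarrow> complex) \<Rightarrow> 'a \<Rightarrow> complex) \<Rightarrow> ('a \<Rightarrow> complex) \<Rightarrow> bool"
where
  "is_maximizer p r K f \<longleftrightarrow>
    f \<in> Lp_space p \<and> Lp_norm p f = 1 \<and> Lp_norm (conj_exponent r) (K f) = op_norm p r K"

end

theory Submission
  imports Defs "HOL-Complex_Analysis.Great_Picard"
begin

text \<open>
  Write \<open>s = r'\<close>, so that \<open>p < s\<close>. Take a maximizing sequence and translate each member so that its mass
  \<open>|f|\<^sup>p\<close> has coordinatewise medians near the origin. If a considerable part of the mass of an almost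
  maximizing \<open>f\<close> lay far from the median, some light strip would separate two considerable parts of
  \<open>f\<close>; their images under a compactly supported approximation of the kernel have disjoint supports,
  so the \<open>s\<close>-th powers of the norms add up, and \<open>\<alpha>\<close> and \<open>\<beta>\<close> with \<open>\<alpha> + \<beta> \<le> 1\<close> enter only through
  \<open>\<alpha> powr (s / p) + \<beta> powr (s / p)\<close>, which is bounded away from 1. Hence the sequence is tight, and
  approximating \<open>k\<close> by continuous kernels of compact support shows that its images are precompact
  in \<open>L\<^sub>s\<close>. No weak limit of the sequence is taken: a maximizer is read off the limit of the images
  by applying Hoelder duality twice.
\<close>

section \<open>Lebesgue spaces of Borel functions\<close>

text \<open>Since convolution commutes with translations, a maximizing sequence may drift away or
  split into pieces that move apart, and its weak limit may vanish. Centring at medians removes the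
  drift; only the splitting needs an estimate. That estimate rests on \<open>p < s\<close>, which
  follows from \<open>1 / s = 1 / p - (1 - 1 / q)\<close> and \<open>q > 1\<close>: with
  \<open>t = s / p\<close> and two masses of sum at most 1, each at most \<open>1 - e\<close>, one
  gets \<open>\<alpha> powr t + \<beta> powr t \<le> (1 - e) powr (t - 1)\<close>, a fixed loss.
  Truncating the kernel and dropping the light strip cost errors that must stay below this loss,
  which dictates the order of the choices: loss, truncated kernel, number of strips, radius. The
  analysis uses Borel functions and \<open>lborel\<close>, where \<open>k (x - y) * f y\<close> is
  jointly measurable as Tonelli requires; Lebesgue measurable functions enter at the end through
  Borel versions.\<close>

definition Lp_mem :: "real \<Rightarrow> ('a::euclidean_space \<Rightarrow> complex) \<Rightarrow> bool" where
  "Lp_mem p f \<longleftrightarrow> f \<in> borel_measurable borel \<and> integrable lborel (\<lambda>x. norm (f x) powr p)"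

text \<open>Real-valued, for plain arithmetic. Where the power \<open>p\<close> of the modulus is
  not integrable, the Bochner integral defaults to 0, so the value is meaningful only together with
  \<open>Lp_mem\<close>.\<close>

definition nrm :: "real \<Rightarrow> ('a::euclidean_space \<Rightarrow> complex) \<Rightarrow> real" where
  "nrm p f = (LINT x|lborel. norm (f x) powr p) powr (1 / p)"

lemma Lp_mem_measurable [measurable_dest]: "Lp_mem p f \<Longrightarrow> f \<in> borel_measurable borel"
  by (simp add: Lp_mem_def)

lemma Lp_mem_integrable: "Lp_mem p f \<Longrightarrow> integrable lborel (\<lambda>x. norm (f x) powr p)"
  by (simp add: Lp_mem_def)

lemma nrm_nonneg [simp]: "0 \<le> nrm p f"
  by (simp add: nrm_def)

lemma nrm_powr:
  assumes "0 < p"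
  shows "nrm p f powr p = (LINT x|lborel. norm (f x) powr p)"
proof -
  have "0 \<le> (LINT x|lborel. norm (f x) powr p)"
    by (rule Bochner_Integration.integral_nonneg) simp
  then show ?thesis using assms by (simp add: nrm_def powr_powr)
qed

lemma nrm_le_iff:
  assumes "0 < p" "0 \<le> c"
  shows "nrm p f \<le> c \<longleftrightarrow> (LINT x|lborel. norm (f x) powr p) \<le> c powr p"
proof -
  have "nrm p f \<le> c \<longleftrightarrow> nrm p f powr p \<le> c powr p"
    using assms by (metis nrm_nonneg powr_mono2 powr_less_mono2 not_less less_imp_le)
  then show ?thesis using assms by (simp add: nrm_powr)
qed

lemma nrm_eq_iff:
  assumes "0 < p" "0 \<le> c"
  shows "nrm p f = c \<longleftrightarrow> (LINT x|lborel. norm (f x) powr p) = c powr p"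
proof
  show "nrm p f = c \<Longrightarrow> (LINT x|lborel. norm (f x) powr p) = c powr p"
    using assms by (simp flip: nrm_powr)
  show "(LINT x|lborel. norm (f x) powr p) = c powr p \<Longrightarrow> nrm p f = c"
    using assms by (simp add: nrm_def powr_powr)
qed

lemma nrm_cong_AE:
  assumes "f \<in> borel_measurable borel" "g \<in> borel_measurable borel" "AE x in lborel. f x = g x"
  shows "nrm p f = nrm p g"
proof -
  have "(LINT x|lborel. norm (f x) powr p) = (LINT x|lborel. norm (g x) powr p)"
    by (rule integral_cong_AE) (use assms in auto)
  then show ?thesis by (simp add: nrm_def)
qed

lemma Lp_mem_dominated:
  assumes "0 < p" "0 \<le> C" "Lp_mem p f" and g [measurable]: "g \<in> borel_measurable borel"
    and le: "AE x in lborel. norm (g x) \<le> C * norm (f x)"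
  shows "Lp_mem p g" "nrm p g \<le> C * nrm p f"
proof -
  note [measurable] = Lp_mem_measurable[OF assms(3)]
  have le': "AE x in lborel. norm (g x) powr p \<le> C powr p * norm (f x) powr p"
    using le
  proof eventually_elim
    case (elim x)
    then have "norm (g x) powr p \<le> (C * norm (f x)) powr p"
      using assms by (intro powr_mono2) auto
    then show ?case using assms by (simp add: powr_mult)
  qed
  have int: "integrable lborel (\<lambda>x. C powr p * norm (f x) powr p)"
    using assms by (simp add: Lp_mem_def)
  have "integrable lborel (\<lambda>x. norm (g x) powr p)"
    by (rule Bochner_Integration.integrable_bound[OF int]) (use le' in auto)
  then show "Lp_mem p g" by (simp add: Lp_mem_def)
  have "(LINT x|lborel. norm (g x) powr p) \<le> (LINT x|lborel. C powr p * norm (f x) powr p)"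
    by (rule integral_mono_AE) (use int le' \<open>integrable lborel (\<lambda>x. norm (g x) powr p)\<close> in auto)
  also have "\<dots> = (C * nrm p f) powr p"
    using assms by (simp add: powr_mult nrm_powr)
  finally show "nrm p g \<le> C * nrm p f"
    using assms by (subst nrm_le_iff) auto
qed

lemma Lp_mem_cmult:
  assumes "0 < p" "Lp_mem p f"
  shows "Lp_mem p (\<lambda>x. c * f x)"
  by (rule Lp_mem_dominated(1)[OF assms(1) _ assms(2), of "norm c"])
    (use Lp_mem_measurable[OF assms(2)] in \<open>auto simp: norm_mult\<close>)

lemma nrm_cmult:
  assumes "0 < p"
  shows "nrm p (\<lambda>x. c * f x) = norm c * nrm p f"
  using assms by (subst nrm_eq_iff) (auto simp: norm_mult powr_mult nrm_powr)

lemma Lp_mem_restrict: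
  assumes "0 < p" "Lp_mem p f" "A \<in> sets borel"
  shows "Lp_mem p (\<lambda>x. indicator A x * f x)" "nrm p (\<lambda>x. indicator A x * f x) \<le> nrm p f"
proof -
  have 1: "(\<lambda>x. indicator A x * f x) \<in> borel_measurable borel"
    using Lp_mem_measurable[OF assms(2)] assms(3) by measurable
  have 2: "AE x in lborel. norm (indicator A x * f x) \<le> 1 * norm (f x)"
    by (auto simp: indicator_def)
  show "Lp_mem p (\<lambda>x. indicator A x * f x)" "nrm p (\<lambda>x. indicator A x * f x) \<le> nrm p f"
    using Lp_mem_dominated[OF assms(1) _ assms(2) 1 2] by auto
qed

text \<open>The crude bound of a sum by twice the larger term gives membership for every positive
  exponent; the sharp constant, in \<open>nrm_triangle\<close>, needs convexity.\<close>

lemma Lp_mem_add: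
  assumes "0 < p" "Lp_mem p f" "Lp_mem p g"
  shows "Lp_mem p (\<lambda>x. f x + g x)"
proof -
  note [measurable] = Lp_mem_measurable[OF assms(2)] Lp_mem_measurable[OF assms(3)]
  have le: "norm (f x + g x) powr p \<le> 2 powr p * norm (f x) powr p + 2 powr p * norm (g x) powr p" for x
  proof -
    have "norm (f x + g x) \<le> 2 * max (norm (f x)) (norm (g x))"
      using norm_triangle_ineq[of "f x" "g x"] by linarith
    then have "norm (f x + g x) powr p \<le> (2 * max (norm (f x)) (norm (g x))) powr p"
      using assms by (intro powr_mono2) auto
    also have "\<dots> = 2 powr p * max (norm (f x)) (norm (g x)) powr p"
      by (simp add: powr_mult)
    also have "\<dots> \<le> 2 powr p * (norm (f x) powr p + norm (g x) powr p)"
      by (intro mult_left_mono) (auto simp: max_def)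
    finally show ?thesis by (simp add: algebra_simps)
  qed
  have "integrable lborel (\<lambda>x. 2 powr p * norm (f x) powr p + 2 powr p * norm (g x) powr p)"
    using assms by (simp add: Lp_mem_def)
  then have "integrable lborel (\<lambda>x. norm (f x + g x) powr p)"
    by (rule Bochner_Integration.integrable_bound) (use le in \<open>auto simp: abs_of_nonneg intro!: AE_I2\<close>)
  then show ?thesis by (simp add: Lp_mem_def)
qed

lemma Lp_mem_diff:
  assumes "0 < p" "Lp_mem p f" "Lp_mem p g"
  shows "Lp_mem p (\<lambda>x. f x - g x)"
  using Lp_mem_add[OF assms(1,2) Lp_mem_cmult[OF assms(1,3), of "-1"]] by simp

lemma nrm_minus_commute: "nrm p (\<lambda>x. f x - g x) = nrm p (\<lambda>x. g x - f x)"
  by (simp add: nrm_def norm_minus_commute)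

lemma nrm_zero_AE:
  assumes "0 < p" "Lp_mem p f" "nrm p f = 0"
  shows "AE x in lborel. f x = 0"
proof -
  have "(LINT x|lborel. norm (f x) powr p) = 0"
    using assms nrm_powr[of p f] by simp
  then have "AE x in lborel. norm (f x) powr p = 0"
    using assms by (subst (asm) integral_nonneg_eq_0_iff_AE) (auto simp: Lp_mem_def)
  then show ?thesis by simp
qed

text \<open>Convexity on the open half-line covers positive arguments. If one argument is 0, the
  claim reduces to \<open>s powr p \<le> s\<close> for weights \<open>s\<close> between 0 and
  1.\<close>

lemma powr_convex_combination:
  fixes u v t p :: real
  assumes "1 \<le> p" "0 \<le> u" "0 \<le> v" "0 < t" "t < 1"
  shows "((1 - t) * u + t * v) powr p \<le> (1 - t) * u powr p + t * v powr p"
proof -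
  have small: "(s * w) powr p \<le> s * w powr p" if "0 < s" "s < 1" "0 \<le> w" for s w :: real
  proof -
    have "s powr p \<le> s powr 1" using that assms by (intro powr_mono') auto
    then show ?thesis using that by (auto simp: powr_mult intro!: mult_right_mono)
  qed
  show ?thesis
  proof (cases "u = 0 \<or> v = 0")
    case True
    then show ?thesis using small[of "1 - t" u] small[of t v] assms by auto
  next
    case False
    then show ?thesis
      using convex_onD[OF powr_convex[OF assms(1)], of t u v] assms by (auto simp: algebra_simps)
  qed
qed

text \<open>Minkowski by convexity: dividing the sum by \<open>?a + ?b\<close> exhibits it as a
  convex combination of the normalized functions, with weights proportional to the norms. A
  vanishing norm cannot be divided by, but then the function is 0 almost everywhere.\<close>

lemma nrm_triangle:
  assumes "1 \<le> p" "Lp_mem p f" "Lp_mem p g"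
  shows "nrm p (\<lambda>x. f x + g x) \<le> nrm p f + nrm p g"
proof -
  have p: "0 < p" using assms by simp
  note [measurable] = Lp_mem_measurable[OF assms(2)] Lp_mem_measurable[OF assms(3)]
  let ?a = "nrm p f" and ?b = "nrm p g"
  consider "?a = 0" | "?b = 0" | "?a > 0" "?b > 0"
    using nrm_nonneg[of p f] nrm_nonneg[of p g] by linarith
  then show ?thesis
  proof cases
    case 1
    have "nrm p (\<lambda>x. f x + g x) = nrm p g"
      by (rule nrm_cong_AE) (use nrm_zero_AE[OF p assms(2) 1] in auto)
    then show ?thesis by simp
  next
    case 2
    have "nrm p (\<lambda>x. f x + g x) = nrm p f"
      by (rule nrm_cong_AE) (use nrm_zero_AE[OF p assms(3) 2] in auto)
    then show ?thesis by simp
  next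
    case 3
    define t where "t = ?b / (?a + ?b)"
    have t: "0 < t" "t < 1" "1 - t = ?a / (?a + ?b)" using 3 by (auto simp: t_def field_simps)
    have le: "norm (f x + g x) powr p \<le> (?a + ?b) powr p *
        ((1 - t) / ?a powr p * norm (f x) powr p + t / ?b powr p * norm (g x) powr p)" for x
    proof -
      have eq: "(?a + ?b) * ((1 - t) * (norm (f x) / ?a) + t * (norm (g x) / ?b)) = norm (f x) + norm (g x)"
      proof -
        have "(1 - t) * (norm (f x) / ?a) = norm (f x) / (?a + ?b)" "t * (norm (g x) / ?b) = norm (g x) / (?a + ?b)"
          unfolding t(3) unfolding t_def using 3 by auto
        then show ?thesis using 3 by (simp add: add_divide_distrib[symmetric])
      qed
      have "norm (f x + g x) powr p \<le> (norm (f x) + norm (g x)) powr p"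
        using p by (intro powr_mono2 norm_triangle_ineq) auto
      also have "\<dots> = (?a + ?b) powr p * ((1 - t) * (norm (f x) / ?a) + t * (norm (g x) / ?b)) powr p"
        using 3 t by (simp flip: eq powr_mult)
      also have "\<dots> \<le> (?a + ?b) powr p * ((1 - t) * (norm (f x) / ?a) powr p + t * (norm (g x) / ?b) powr p)"
        using 3 t assms(1) by (intro mult_left_mono powr_convex_combination) auto
      finally show ?thesis using 3 by (simp add: powr_divide)
    qed
    have if_: "integrable lborel (\<lambda>x. norm (f x) powr p)" and ig: "integrable lborel (\<lambda>x. norm (g x) powr p)"
      using assms by (auto simp: Lp_mem_def)
    have int: "integrable lborel (\<lambda>x. (?a + ?b) powr p *
        ((1 - t) / ?a powr p * norm (f x) powr p + t / ?b powr p * norm (g x) powr p))"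
      using if_ ig by (intro Bochner_Integration.integrable_mult_right Bochner_Integration.integrable_add) auto
    have "(LINT x|lborel. norm (f x + g x) powr p) \<le> (LINT x|lborel. (?a + ?b) powr p *
        ((1 - t) / ?a powr p * norm (f x) powr p + t / ?b powr p * norm (g x) powr p))"
      using Lp_mem_add[OF p assms(2,3)] int le by (intro Bochner_Integration.integral_mono) (auto simp: Lp_mem_def)
    also have "\<dots> = (?a + ?b) powr p * ((1 - t) / ?a powr p * ?a powr p + t / ?b powr p * ?b powr p)"
      using if_ ig p by (simp add: nrm_powr)
    also have "\<dots> = (?a + ?b) powr p" using 3 by simp
    finally show ?thesis using p by (subst nrm_le_iff) auto
  qed
qed

lemma nrm_triangle_diff:
  assumes "1 \<le> p" "Lp_mem p f" "Lp_mem p g"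
  shows "nrm p f \<le> nrm p g + nrm p (\<lambda>x. f x - g x)"
  using nrm_triangle[OF assms(1,3) Lp_mem_diff[OF _ assms(2,3)]] assms(1) by simp

text \<open>The pointwise Young inequality for products gives integrability at once; applied to
  \<open>f\<close> and \<open>g\<close> divided by their norms it gives the constant 1.\<close>

lemma Holder:
  assumes "1 < p" "1 < q" "1 / p + 1 / q = 1" "Lp_mem p f" "Lp_mem q g"
  shows "integrable lborel (\<lambda>x. f x * g x)"
    and "(LINT x|lborel. norm (f x * g x)) \<le> nrm p f * nrm q g"
    and "norm (LINT x|lborel. f x * g x) \<le> nrm p f * nrm q g"
proof -
  note [measurable] = Lp_mem_measurable[OF assms(4)] Lp_mem_measurable[OF assms(5)]
  have if_: "integrable lborel (\<lambda>x. norm (f x) powr p)" and ig: "integrable lborel (\<lambda>x. norm (g x) powr q)"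
    using assms by (auto simp: Lp_mem_def)
  have "integrable lborel (\<lambda>x. norm (f x) powr p / p + norm (g x) powr q / q)"
    using if_ ig by auto
  then show int: "integrable lborel (\<lambda>x. f x * g x)"
    by (rule Bochner_Integration.integrable_bound)
      (use assms Youngs_inequality[OF assms(1-3) norm_ge_zero norm_ge_zero] in \<open>auto simp: norm_mult intro!: order_trans[OF _ abs_ge_self]\<close>)
  show le: "(LINT x|lborel. norm (f x * g x)) \<le> nrm p f * nrm q g"
  proof (cases "nrm p f = 0 \<or> nrm q g = 0")
    case True
    then have "AE x in lborel. f x * g x = 0"
      using nrm_zero_AE[OF _ assms(4)] nrm_zero_AE[OF _ assms(5)] assms(1,2) by fastforce
    then have "(LINT x|lborel. norm (f x * g x)) = 0"
      by (intro integral_eq_zero_AE) auto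
    then show ?thesis by simp
  next
    case False
    let ?a = "nrm p f" and ?b = "nrm q g"
    have pos: "?a > 0" "?b > 0" using False nrm_nonneg[of p f] nrm_nonneg[of q g] by linarith+
    have "norm (f x * g x) \<le> ?a * ?b * (norm (f x) powr p / ?a powr p / p + norm (g x) powr q / ?b powr q / q)" for x
    proof -
      have "norm (f x * g x) = ?a * ?b * ((norm (f x) / ?a) * (norm (g x) / ?b))"
        using pos by (simp add: norm_mult)
      also have "\<dots> \<le> ?a * ?b * ((norm (f x) / ?a) powr p / p + (norm (g x) / ?b) powr q / q)"
        using pos assms by (intro mult_left_mono Youngs_inequality) auto
      finally show ?thesis using pos by (simp add: powr_divide)
    qed
    then have "(LINT x|lborel. norm (f x * g x)) \<le>
      (LINT x|lborel. ?a * ?b * (norm (f x) powr p / ?a powr p / p + norm (g x) powr q / ?b powr q / q))"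
      using if_ ig int by (intro Bochner_Integration.integral_mono) auto
    also have "\<dots> = ?a * ?b * (?a powr p / ?a powr p / p + ?b powr q / ?b powr q / q)"
      using if_ ig assms(1,2) by (simp add: nrm_powr)
    also have "\<dots> = ?a * ?b" using pos assms(3) by simp
    finally show ?thesis .
  qed
  show "norm (LINT x|lborel. f x * g x) \<le> nrm p f * nrm q g"
    using integral_norm_bound[of lborel "\<lambda>x. f x * g x"] le by linarith
qed

text \<open>The equality case of Hoelder's inequality, with an explicit extremal. The pairing is
  bilinear, so the conjugation sits inside \<open>h\<close>.\<close>

lemma Lp_dual_function:
  assumes "1 < p" "1 < q" "1 / p + 1 / q = 1" "Lp_mem p f" "0 < nrm p f"
  obtains h where "Lp_mem q h" "nrm q h = 1" "(LINT x|lborel. f x * h x) = of_real (nrm p f)"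
proof -
  note [measurable] = Lp_mem_measurable[OF assms(4)]
  let ?N = "nrm p f"
  \<comment> \<open>The factor \<open>cnj (f x)\<close> makes \<open>h\<close> vanish where
    \<open>f\<close> does, so a negative exponent \<open>p - 2\<close> does no harm. Because
    \<open>(p - 1) * q = p\<close>, the power \<open>q\<close> of the modulus of \<open>h\<close> is
    the normalized power \<open>p\<close> of that of \<open>f\<close>.\<close>
  define h where "h x = of_real (norm (f x) powr (p - 2) / ?N powr (p - 1)) * cnj (f x)" for x
  have hm: "h \<in> borel_measurable borel"
  proof -
    have "(\<lambda>x. cnj (f x)) \<in> borel_measurable borel"
      using assms(4) by (intro borel_measurable_continuous_on[OF _ Lp_mem_measurable]) (auto intro!: continuous_intros)
    then show ?thesis unfolding h_def by measurable
  qed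
  have pq: "(p - 1) * q = p" using assms by (simp add: field_simps)
  have nh: "norm (h x) = norm (f x) powr (p - 1) / ?N powr (p - 1)" for x
  proof (cases "f x = 0")
    case False
    have "norm (f x) powr (p - 2) * norm (f x) = norm (f x) powr (p - 1)"
      using False powr_add[of "norm (f x)" "p - 2" 1] by simp
    then show ?thesis by (simp add: h_def norm_mult norm_divide)
  qed (simp add: h_def)
  have hq: "norm (h x) powr q = norm (f x) powr p / ?N powr p" for x
    by (simp add: nh powr_divide powr_powr pq)
  have fh: "f x * h x = of_real (norm (f x) powr p / ?N powr (p - 1))" for x
  proof (cases "f x = 0")
    case False
    have "norm (f x) powr (p - 2) * (norm (f x))\<^sup>2 = norm (f x) powr p"
      using False powr_add[of "norm (f x)" "p - 2" 2] by simp
    moreover have "f x * cnj (f x) = of_real ((norm (f x))\<^sup>2)"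
      using complex_norm_square[of "f x"] by simp
    ultimately show ?thesis
      by (simp add: h_def mult.assoc mult.left_commute[of "f x"] flip: of_real_mult of_real_power)
  qed (simp add: h_def)
  show thesis
  proof
    show "Lp_mem q h"
      using assms hm by (simp add: Lp_mem_def hq)
    show "nrm q h = 1"
      using assms by (subst nrm_eq_iff) (auto simp: hq nrm_powr[symmetric])
    have "(LINT x|lborel. f x * h x) = of_real (LINT x|lborel. norm (f x) powr p / ?N powr (p - 1))"
      unfolding fh by (rule integral_complex_of_real)
    also have "(LINT x|lborel. norm (f x) powr p / ?N powr (p - 1)) = ?N powr p / ?N powr (p - 1)"
      using assms by (simp add: nrm_powr)
    also have "\<dots> = ?N" using assms(5) by (simp flip: powr_diff)
    finally show "(LINT x|lborel. f x * h x) = of_real ?N" .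
  qed
qed

section \<open>Convolution and Young's inequality\<close>

lemma lborel_reflect: "distr lborel borel (\<lambda>y. t - y) = (lborel :: 'a::euclidean_space measure)"
  using lborel_affine[of "-1" t] by (simp add: density_1)

lemma lborel_shift: "distr lborel borel (\<lambda>y. y + t) = (lborel :: 'a::euclidean_space measure)"
proof -
  have "(\<lambda>y. y + t) = (+) t" by (auto simp: add.commute)
  then show ?thesis using lborel_distr_plus[of t] by simp
qed

lemma
  fixes T :: "'a::euclidean_space \<Rightarrow> 'a"
  assumes [measurable]: "T \<in> borel_measurable borel" and T: "distr lborel borel T = (lborel :: 'a measure)"
  shows nn_integral_lborel_subst: "g \<in> borel_measurable borel \<Longrightarrow> (\<integral>\<^sup>+y. g (T y) \<partial>lborel) = (\<integral>\<^sup>+y. g y \<partial>lborel)"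
    and integral_lborel_subst: "G \<in> borel_measurable borel \<Longrightarrow> (LINT y|lborel. G (T y)) = (LINT y|lborel. (G y :: 'b::{banach, second_countable_topology}))"
    and integrable_lborel_subst: "G \<in> borel_measurable borel \<Longrightarrow> integrable lborel (\<lambda>y. G (T y)) \<longleftrightarrow> integrable lborel G"
    and AE_lborel_subst: "(AE y in lborel. P y) \<Longrightarrow> AE y in lborel. P (T y)"
proof -
  show "(\<integral>\<^sup>+y. g (T y) \<partial>lborel) = (\<integral>\<^sup>+y. g y \<partial>lborel)" if [measurable]: "g \<in> borel_measurable borel"
    using nn_integral_distr[of T lborel borel g] by (simp add: T)
  show "(LINT y|lborel. G (T y)) = (LINT y|lborel. G y)" if [measurable]: "G \<in> borel_measurable borel"
    using integral_distr[of T lborel borel G] by (simp add: T)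
  show "integrable lborel (\<lambda>y. G (T y)) \<longleftrightarrow> integrable lborel G" if [measurable]: "G \<in> borel_measurable borel"
    using integrable_distr_eq[of T lborel borel G] by (simp add: T)
  show "AE y in lborel. P (T y)" if "AE y in lborel. P y"
  proof (rule AE_distrD[where f = T and M = lborel and M' = borel and P = P])
    show "T \<in> measurable lborel borel" by simp
    show "AE y in distr lborel borel T. P y" unfolding T by (rule that)
  qed
qed

lemmas integral_reflect = integral_lborel_subst[OF _ lborel_reflect]
  and integrable_reflect = integrable_lborel_subst[OF _ lborel_reflect]
  and AE_reflect = AE_lborel_subst[OF _ lborel_reflect]
  and nn_integral_shift = nn_integral_lborel_subst[OF _ lborel_shift]
  and integral_shift = integral_lborel_subst[OF _ lborel_shift]
  and integrable_shift = integrable_lborel_subst[OF _ lborel_shift]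

lemma Lp_reflect:
  assumes "Lp_mem p f"
  shows "Lp_mem p (\<lambda>y. f (t - y))" "nrm p (\<lambda>y. f (t - y)) = nrm p f"
proof -
  note [measurable] = Lp_mem_measurable[OF assms]
  have m: "(\<lambda>x. norm (f x) powr p) \<in> borel_measurable borel" by measurable
  show "Lp_mem p (\<lambda>y. f (t - y))" "nrm p (\<lambda>y. f (t - y)) = nrm p f"
    using assms integral_reflect[of t, OF _ m] integrable_reflect[of t, OF _ m]
    by (auto simp: Lp_mem_def nrm_def)
qed

lemma Lp_shift:
  assumes "Lp_mem p f"
  shows "Lp_mem p (\<lambda>y. f (y + t))" "nrm p (\<lambda>y. f (y + t)) = nrm p f"
proof -
  note [measurable] = Lp_mem_measurable[OF assms]
  have m: "(\<lambda>x. norm (f x) powr p) \<in> borel_measurable borel" by measurable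
  show "Lp_mem p (\<lambda>y. f (y + t))" "nrm p (\<lambda>y. f (y + t)) = nrm p f"
    using assms integral_shift[of t, OF _ m] integrable_shift[of t, OF _ m]
    by (auto simp: Lp_mem_def nrm_def)
qed

definition conv :: "('a::euclidean_space \<Rightarrow> complex) \<Rightarrow> ('a \<Rightarrow> complex) \<Rightarrow> 'a \<Rightarrow> complex" where
  "conv k f x = (LINT y|lborel. k (x - y) * f y)"

lemma conv_measurable [measurable]:
  assumes [measurable]: "k \<in> borel_measurable borel" "f \<in> borel_measurable borel"
  shows "conv k f \<in> borel_measurable borel"
proof -
  have "(\<lambda>x. LINT y|lborel. k (x - y) * f y) \<in> borel_measurable borel"
    by (rule lborel.borel_measurable_lebesgue_integral) measurable
  then show ?thesis by (simp add: conv_def[abs_def])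
qed

lemma conv_cmult: "conv k (\<lambda>x. c * f x) x = c * conv k f x"
  unfolding conv_def by (subst Bochner_Integration.integral_mult_right_zero[symmetric]) (simp add: mult.left_commute)

lemma conv_cmult_left: "conv (\<lambda>x. c * k x) f x = c * conv k f x"
  unfolding conv_def by (subst Bochner_Integration.integral_mult_right_zero[symmetric]) (simp add: mult.assoc)

lemma conv_shift:
  assumes [measurable]: "k \<in> borel_measurable borel" "f \<in> borel_measurable borel"
  shows "conv k (\<lambda>y. f (y + t)) x = conv k f (x + t)"
proof -
  have "(\<lambda>z. k (x + t - z) * f z) \<in> borel_measurable borel" by measurable
  from integral_shift[of t, OF _ this] show ?thesis
    by (simp add: conv_def)
qed

section \<open>Young's inequality for convolutions and the adjoint convolution\<close>

lemma weighted_AM_GM3: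
  fixes x y z \<alpha> \<beta> \<gamma> :: real
  assumes "0 < x" "0 < y" "0 < z" "0 < \<alpha>" "0 < \<beta>" "0 < \<gamma>" "\<alpha> + \<beta> + \<gamma> = 1"
  shows "x powr \<alpha> * y powr \<beta> * z powr \<gamma> \<le> \<alpha> * x + \<beta> * y + \<gamma> * z"
proof -
  let ?d = "\<beta> + \<gamma>"
  define w where "w = y powr (\<beta> / ?d) * z powr (\<gamma> / ?d)"
  have w: "w \<le> \<beta> / ?d * y + \<gamma> / ?d * z" unfolding w_def
    by (rule Youngs_inequality_0) (use assms in \<open>auto simp: add_divide_distrib[symmetric]\<close>)
  have "x powr \<alpha> * y powr \<beta> * z powr \<gamma> = x powr \<alpha> * w powr ?d"
    using assms by (simp add: w_def powr_mult powr_powr)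
  also have "\<dots> \<le> \<alpha> * x + ?d * w"
    by (rule Youngs_inequality_0) (use assms in \<open>auto simp: w_def\<close>)
  also have "?d * w \<le> ?d * (\<beta> / ?d * y + \<gamma> / ?d * z)"
    using w assms by (intro mult_left_mono) auto
  also have "\<dots> = \<beta> * y + \<gamma> * z" using assms by (simp add: distrib_left)
  finally show ?thesis by simp
qed

text \<open>
  Three-term AM-GM. With \<open>u = |k (x - y)|\<close>, \<open>v = |f y|\<close> and \<open>a\<close> the integral of \<open>u powr q * v powr p\<close> over
  \<open>y\<close>, integration gives \<open>|(k * f) x| powr s \<le> a\<close> for normalized \<open>k\<close> and \<open>f\<close>, and \<open>a\<close> has integral 1 over
  \<open>x\<close> by Tonelli.
\<close>

lemma Young_pointwise:
  fixes p q s a u v :: real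
  assumes "1 < p" "1 < q" "1 < s" "1 / p + 1 / q = 1 + 1 / s" "0 < a" "0 \<le> u" "0 \<le> v"
  shows "u * v \<le> a powr (1 / s) * (1 / s * (u powr q * v powr p / a) + (1 - 1 / p) * u powr q + (1 - 1 / q) * v powr p)"
proof (cases "u = 0 \<or> v = 0")
  case True
  have "0 \<le> 1 - 1 / p" "0 \<le> 1 - 1 / q" using assms by auto
  then show ?thesis using True assms by auto
next
  case False
  then have pos: "0 < u" "0 < v" using assms by auto
  have e1: "q * (1 / s) + q * (1 - 1 / p) = 1"
  proof -
    have "1 / s + (1 - 1 / p) = 1 / q" using assms(4) by linarith
    then have "q * (1 / s + (1 - 1 / p)) = 1" using assms(2) by simp
    then show ?thesis by (simp only: distrib_left)
  qed
  have e2: "p * (1 / s) + p * (1 - 1 / q) = 1"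
  proof -
    have "1 / s + (1 - 1 / q) = 1 / p" using assms(4) by linarith
    then have "p * (1 / s + (1 - 1 / q)) = 1" using assms(1) by simp
    then show ?thesis by (simp only: distrib_left)
  qed
  have "a powr (1 / s) * ((u powr q * v powr p / a) powr (1 / s) * (u powr q) powr (1 - 1 / p) * (v powr p) powr (1 - 1 / q))
     = (u powr (q * (1 / s)) * u powr (q * (1 - 1 / p))) * (v powr (p * (1 / s)) * v powr (p * (1 - 1 / q)))"
    using assms(5) by (simp add: powr_divide powr_mult powr_powr)
  also have "\<dots> = u * v" using pos by (simp only: powr_add[symmetric] e1 e2) simp
  finally have "u * v = a powr (1 / s) * ((u powr q * v powr p / a) powr (1 / s) * (u powr q) powr (1 - 1 / p) * (v powr p) powr (1 - 1 / q))"
    by simp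
  also have "\<dots> \<le> a powr (1 / s) * (1 / s * (u powr q * v powr p / a) + (1 - 1 / p) * u powr q + (1 - 1 / q) * v powr p)"
    by (rule mult_left_mono, rule weighted_AM_GM3) (use assms pos in auto)
  finally show ?thesis .
qed

text \<open>\<open>A\<close> takes values in \<open>ennreal\<close>, so Tonelli applies before any
  integrability is known. Its integral is 1, hence it is finite almost everywhere, and finiteness of
  \<open>A x\<close> yields both the integrability at \<open>x\<close> and the bound there.\<close>

lemma Young_normalized:
  assumes pqs: "1 < p" "1 < q" "1 < s" "1 / p + 1 / q = 1 + 1 / s"
    and "Lp_mem q k" "Lp_mem p f" "nrm q k = 1" "nrm p f = 1"
  shows "AE x in lborel. integrable lborel (\<lambda>y. k (x - y) * f y)"
    and "Lp_mem s (conv k f)" and "nrm s (conv k f) \<le> 1"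
proof -
  note [measurable] = Lp_mem_measurable[OF assms(5)] Lp_mem_measurable[OF assms(6)]
  have ik: "integrable lborel (\<lambda>x. norm (k x) powr q)" and "integrable lborel (\<lambda>x. norm (f x) powr p)"
    using assms by (auto simp: Lp_mem_def)
  have Ik: "(LINT x|lborel. norm (k x) powr q) = 1" and If: "(LINT x|lborel. norm (f x) powr p) = 1"
    using nrm_powr[of q k] nrm_powr[of p f] assms by auto
  have nk: "(\<integral>\<^sup>+x. ennreal (norm (k x) powr q) \<partial>lborel) = 1" and nf: "(\<integral>\<^sup>+x. ennreal (norm (f x) powr p) \<partial>lborel) = 1"
    using Ik If ik \<open>integrable lborel (\<lambda>x. norm (f x) powr p)\<close> by (simp_all add: nn_integral_eq_integral)
  define G where "G x y = norm (k (x - y)) powr q * norm (f y) powr p" for x y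
  define A where "A x = (\<integral>\<^sup>+y. ennreal (G x y) \<partial>lborel)" for x
  have G_meas [measurable]: "(\<lambda>(x, y). G x y) \<in> borel_measurable (borel \<Otimes>\<^sub>M borel)"
    unfolding G_def by measurable
  have A_meas [measurable]: "A \<in> borel_measurable borel"
    unfolding A_def[abs_def] by measurable
  have "(\<integral>\<^sup>+x. A x \<partial>lborel) = (\<integral>\<^sup>+y. (\<integral>\<^sup>+x. ennreal (G x y) \<partial>lborel) \<partial>lborel)"
    unfolding A_def by (rule lborel_pair.Fubini') measurable
  also have "\<dots> = (\<integral>\<^sup>+y. ennreal (norm (f y) powr p) \<partial>lborel)"
  proof (rule nn_integral_cong)
    fix y
    have "(\<integral>\<^sup>+x. ennreal (G x y) \<partial>lborel) = (\<integral>\<^sup>+x. ennreal (norm (f y) powr p) * ennreal (norm (k (x + (-y))) powr q) \<partial>lborel)"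
      by (simp add: G_def ennreal_mult mult.commute)
    also have "\<dots> = ennreal (norm (f y) powr p) * (\<integral>\<^sup>+x. ennreal (norm (k (x + (-y))) powr q) \<partial>lborel)"
      by (rule nn_integral_cmult) measurable
    also have "(\<integral>\<^sup>+x. ennreal (norm (k (x + (-y))) powr q) \<partial>lborel) = 1"
      using nn_integral_shift[of "-y" "\<lambda>x. ennreal (norm (k x) powr q)"] nk by simp
    finally show "(\<integral>\<^sup>+x. ennreal (G x y) \<partial>lborel) = ennreal (norm (f y) powr p)" by simp
  qed
  finally have IA: "(\<integral>\<^sup>+x. A x \<partial>lborel) = 1" using nf by simp
  then have AE_A: "AE x in lborel. A x \<noteq> \<infinity>"
    by (intro nn_integral_PInf_AE) auto
  have ptw: "integrable lborel (\<lambda>y. k (x - y) * f y) \<and> norm (conv k f x) powr s \<le> enn2real (A x)"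
    if "A x \<noteq> \<infinity>" for x
  proof -
    have iG: "integrable lborel (G x)"
      using that unfolding A_def by (intro integrableI_nonneg) (auto simp: G_def less_top)
    define a where "a = enn2real (A x)"
    have a: "a = (LINT y|lborel. G x y)"
      unfolding a_def A_def by (subst nn_integral_eq_integral[OF iG]) (auto simp: G_def intro!: enn2real_ennreal Bochner_Integration.integral_nonneg)
    have ikx: "integrable lborel (\<lambda>y. norm (k (x - y)) powr q)"
      using integrable_reflect[of x "\<lambda>x. norm (k x) powr q"] ik by simp
    have Ikx: "(LINT y|lborel. norm (k (x - y)) powr q) = 1"
      using integral_reflect[of x "\<lambda>x. norm (k x) powr q"] Ik by simp
    show ?thesis
    \<comment> \<open>\<open>Young_pointwise\<close> divides by \<open>a\<close>; for
      \<open>a = 0\<close> the integrand itself vanishes almost everywhere.\<close>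
    proof (cases "a = 0")
      case True
      then have "integral\<^sup>L lborel (G x) = 0" using a by simp
      then have "AE y in lborel. G x y = 0"
        by (subst (asm) integral_nonneg_eq_0_iff_AE[OF iG]) (auto simp: G_def)
      then have z: "AE y in lborel. k (x - y) * f y = 0" by (simp add: G_def)
      have "integrable lborel (\<lambda>y. k (x - y) * f y) \<longleftrightarrow> integrable lborel (\<lambda>y::'a. 0::complex)"
        by (rule integrable_cong_AE) (use z in auto)
      moreover have "conv k f x = 0"
        unfolding conv_def by (rule integral_eq_zero_AE[OF z])
      ultimately show ?thesis by simp
    next
      case False
      then have "0 < a" unfolding a_def by (simp add: less_le)
      let ?B = "\<lambda>y. a powr (1 / s) * (1 / s * (G x y / a) + (1 - 1 / p) * norm (k (x - y)) powr q + (1 - 1 / q) * norm (f y) powr p)"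
      have le: "norm (k (x - y) * f y) \<le> ?B y" for y
        unfolding norm_mult G_def using pqs \<open>0 < a\<close> by (intro Young_pointwise) auto
      have iB: "integrable lborel ?B"
        using iG ikx assms(6) by (auto simp: Lp_mem_def)
      have int: "integrable lborel (\<lambda>y. k (x - y) * f y)"
        by (rule Bochner_Integration.integrable_bound[OF iB]) (use le in \<open>auto intro!: order_trans[OF _ abs_ge_self]\<close>)
      have "norm (conv k f x) \<le> (LINT y|lborel. norm (k (x - y) * f y))"
        unfolding conv_def by (rule integral_norm_bound)
      also have "\<dots> \<le> (LINT y|lborel. ?B y)"
        by (rule Bochner_Integration.integral_mono) (use int iB le in auto)
      \<comment> \<open>Each of the three terms has integral 1 up to its weight, and the weights add
        up to 1 by the relation between the exponents.\<close>
      also have "\<dots> = a powr (1 / s) * (1 / s * (a / a) + (1 - 1 / p) * 1 + (1 - 1 / q) * 1)"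
        using iG ikx Ikx If assms(6) by (simp add: Lp_mem_def a)
      also have "\<dots> = a powr (1 / s)"
      proof -
        have "1 / s + (1 - 1 / p) + (1 - 1 / q) = 1" using pqs(4) by linarith
        then show ?thesis using \<open>0 < a\<close> by simp
      qed
      finally have "norm (conv k f x) powr s \<le> (a powr (1 / s)) powr s"
        using pqs by (intro powr_mono2) auto
      then show ?thesis using int pqs \<open>0 < a\<close> by (simp add: powr_powr a_def)
    qed
  qed
  show "AE x in lborel. integrable lborel (\<lambda>y. k (x - y) * f y)"
    using AE_A by eventually_elim (use ptw in auto)
  have le: "AE x in lborel. norm (conv k f x) powr s \<le> enn2real (A x)"
    using AE_A by eventually_elim (use ptw in auto)
  have eA: "AE x in lborel. ennreal (enn2real (A x)) = A x"
    using AE_A by eventually_elim (simp add: less_top)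
  then have nA: "(\<integral>\<^sup>+x. ennreal (enn2real (A x)) \<partial>lborel) = 1"
    using IA by (subst nn_integral_cong_AE) auto
  have iA: "integrable lborel (\<lambda>x. enn2real (A x))"
    using nA by (intro integrableI_nonneg) auto
  have "ennreal (LINT x|lborel. enn2real (A x)) = 1"
    using nA by (subst nn_integral_eq_integral[OF iA, symmetric]) auto
  then have IA': "(LINT x|lborel. enn2real (A x)) = 1" by simp
  have ic: "integrable lborel (\<lambda>x. norm (conv k f x) powr s)"
    by (rule Bochner_Integration.integrable_bound[OF iA]) (use le in auto)
  then show "Lp_mem s (conv k f)" by (simp add: Lp_mem_def)
  have "(LINT x|lborel. norm (conv k f x) powr s) \<le> (LINT x|lborel. enn2real (A x))"
    using ic iA le by (rule integral_mono_AE)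
  then show "nrm s (conv k f) \<le> 1" using pqs IA' by (subst nrm_le_iff) auto
qed

lemma conv_AE_zero:
  assumes "(AE x in lborel. k x = 0) \<or> (AE x in lborel. f x = 0)"
    and [measurable]: "k \<in> borel_measurable borel" "f \<in> borel_measurable borel"
  shows "integrable lborel (\<lambda>y. k (x - y) * f y)" "conv k f x = 0"
proof -
  have z: "AE y in lborel. k (x - y) * f y = 0"
    using assms(1)
  proof
    assume "AE x in lborel. k x = 0"
    from AE_reflect[of x, OF _ this] have "AE y in lborel. k (x - y) = 0" by simp
    then show ?thesis by eventually_elim simp
  qed auto
  have "integrable lborel (\<lambda>y. k (x - y) * f y) \<longleftrightarrow> integrable lborel (\<lambda>y::'a. 0::complex)"
    by (rule integrable_cong_AE) (use z in auto)
  then show "integrable lborel (\<lambda>y. k (x - y) * f y)" by simp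
  show "conv k f x = 0" unfolding conv_def by (rule integral_eq_zero_AE[OF z])
qed

theorem Young:
  assumes pqs: "1 < p" "1 < q" "1 < s" "1 / p + 1 / q = 1 + 1 / s"
    and k: "Lp_mem q k" and f: "Lp_mem p f"
  shows "AE x in lborel. integrable lborel (\<lambda>y. k (x - y) * f y)"
    and "Lp_mem s (conv k f)" and "nrm s (conv k f) \<le> nrm q k * nrm p f"
proof -
  note [measurable] = Lp_mem_measurable[OF k] Lp_mem_measurable[OF f]
  have "(AE x in lborel. integrable lborel (\<lambda>y. k (x - y) * f y)) \<and> Lp_mem s (conv k f) \<and> nrm s (conv k f) \<le> nrm q k * nrm p f"
  proof (cases "nrm q k = 0 \<or> nrm p f = 0")
    case True
    then have z: "(AE x in lborel. k x = 0) \<or> (AE x in lborel. f x = 0)"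
      using nrm_zero_AE[OF _ k] nrm_zero_AE[OF _ f] pqs by auto
    have "conv k f = (\<lambda>x. 0)" using conv_AE_zero(2)[OF z] by auto
    then show ?thesis using conv_AE_zero(1)[OF z] pqs by (simp add: Lp_mem_def) (simp add: nrm_def)
  next
    case False
    then have pos: "nrm q k > 0" "nrm p f > 0" using nrm_nonneg[of q k] nrm_nonneg[of p f] by linarith+
    let ?c = "complex_of_real (1 / nrm q k)" and ?d = "complex_of_real (1 / nrm p f)"
    let ?k = "\<lambda>x. ?c * k x" and ?f = "\<lambda>x. ?d * f x"
    have k': "Lp_mem q ?k" "nrm q ?k = 1" and f': "Lp_mem p ?f" "nrm p ?f = 1"
      using Lp_mem_cmult[OF _ k, of ?c] Lp_mem_cmult[OF _ f, of ?d] pqs pos by (auto simp: nrm_cmult norm_divide simp del: of_real_divide)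
    note Y = Young_normalized[OF pqs k'(1) f'(1) k'(2) f'(2)]
    have eq: "conv ?k ?f = (\<lambda>x. (?c * ?d) * conv k f x)"
    proof
      fix x
      have "conv ?k ?f x = ?c * conv k ?f x" by (rule conv_cmult_left)
      also have "conv k ?f x = ?d * conv k f x" by (rule conv_cmult)
      finally show "conv ?k ?f x = (?c * ?d) * conv k f x" by (simp only: mult.assoc)
    qed
    have undo: "(\<lambda>x. (1 / (?c * ?d)) * conv ?k ?f x) = conv k f"
      unfolding eq using pos by (auto simp: field_simps)
    have mem: "Lp_mem s (conv k f)"
      using Lp_mem_cmult[OF _ Y(2), of "1 / (?c * ?d)"] pqs unfolding undo by simp
    have "norm (?c * ?d) * nrm s (conv k f) \<le> 1"
      using Y(3) pqs unfolding eq by (simp only: nrm_cmult)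
    moreover have "norm (?c * ?d) = 1 / (nrm q k * nrm p f)" using pos by (simp add: norm_mult norm_divide)
    ultimately have "1 / (nrm q k * nrm p f) * nrm s (conv k f) \<le> 1" by (simp only:)
    then have "nrm s (conv k f) \<le> nrm q k * nrm p f" using pos by (simp add: field_simps)
    moreover have "AE x in lborel. integrable lborel (\<lambda>y. k (x - y) * f y)"
      using Y(1)
    proof eventually_elim
      case (elim x)
      then have "integrable lborel (\<lambda>y. (1 / (?c * ?d)) * (?k (x - y) * ?f y))" by (rule Bochner_Integration.integrable_mult_right)
      moreover have "(\<lambda>y. (1 / (?c * ?d)) * (?k (x - y) * ?f y)) = (\<lambda>y. k (x - y) * f y)"
        using pos by (auto simp: field_simps)
      ultimately show ?case by simp
    qed
    ultimately show ?thesis using mem by blast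
  qed
  then show "AE x in lborel. integrable lborel (\<lambda>y. k (x - y) * f y)"
    and "Lp_mem s (conv k f)" and "nrm s (conv k f) \<le> nrm q k * nrm p f" by auto
qed

text \<open>Additivity needs both integrals to exist, hence holds almost everywhere only;
  homogeneity and translation, in contrast, hold at every point because the default value 0 respects
  them.\<close>

lemma conv_add_right:
  assumes pqs: "1 < p" "1 < q" "1 < s" "1 / p + 1 / q = 1 + 1 / s"
    and "Lp_mem q k" "Lp_mem p f" "Lp_mem p g"
  shows "AE x in lborel. conv k (\<lambda>x. f x + g x) x = conv k f x + conv k g x"
  using Young(1)[OF pqs assms(5,6)] Young(1)[OF pqs assms(5,7)]
  by eventually_elim (simp add: conv_def distrib_left)

lemma conv_diff_left:
  assumes pqs: "1 < p" "1 < q" "1 < s" "1 / p + 1 / q = 1 + 1 / s"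
    and "Lp_mem q k" "Lp_mem q k'" "Lp_mem p f"
  shows "AE x in lborel. conv (\<lambda>x. k x - k' x) f x = conv k f x - conv k' f x"
  using Young(1)[OF pqs assms(5,7)] Young(1)[OF pqs assms(6,7)]
  by eventually_elim (simp add: conv_def left_diff_distrib)

text \<open>Fubini, the adjoint being convolution with the reflected kernel. Absolute integrability
  on the product comes from Young's inequality for the moduli of \<open>k\<close> and
  \<open>f\<close>, followed by Hoelder against \<open>h\<close>.\<close>

lemma conv_duality:
  assumes pqs: "1 < p" "1 < q" "1 < s" "1 / p + 1 / q = 1 + 1 / s" and rs: "1 < r" "1 / s + 1 / r = 1"
    and k: "Lp_mem q k" and f: "Lp_mem p f" and h: "Lp_mem r h"
  shows "(LINT x|lborel. conv k f x * h x) = (LINT y|lborel. conv (\<lambda>z. k (- z)) h y * f y)"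
proof -
  note [measurable] = Lp_mem_measurable[OF k] Lp_mem_measurable[OF f] Lp_mem_measurable[OF h]
  let ?k = "\<lambda>x. complex_of_real (norm (k x))" and ?f = "\<lambda>x. complex_of_real (norm (f x))"
  have k': "Lp_mem q ?k" and f': "Lp_mem p ?f"
    using k f by (auto simp: Lp_mem_def)
  define F where "F x y = k (x - y) * f y * h x" for x y
  have Fm [measurable]: "(\<lambda>(x, y). F x y) \<in> borel_measurable (borel \<Otimes>\<^sub>M borel)"
    unfolding F_def by measurable
  have "integrable lborel (\<lambda>x. conv ?k ?f x * h x)"
    by (rule Holder(1)[OF pqs(3) rs(1,2) Young(2)[OF pqs k' f'] h])
  then have "integrable lborel (\<lambda>x. norm (conv ?k ?f x * h x))" by (rule integrable_norm)
  also have "(\<lambda>x. norm (conv ?k ?f x * h x)) = (\<lambda>x. LINT y|lborel. norm (F x y))"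
  proof
    fix x
    have "conv ?k ?f x = complex_of_real (LINT y|lborel. norm (k (x - y) * f y))"
      unfolding conv_def by (simp add: norm_mult flip: integral_complex_of_real)
    then show "norm (conv ?k ?f x * h x) = (LINT y|lborel. norm (F x y))"
      by (simp add: F_def norm_mult)
  qed
  finally have i1: "integrable lborel (\<lambda>x. LINT y|lborel. norm (F x y))" .
  have i2: "AE x in lborel. integrable lborel (F x)"
    using Young(1)[OF pqs k f] by eventually_elim (simp add: F_def[abs_def])
  have iF: "integrable (lborel \<Otimes>\<^sub>M lborel) (\<lambda>(x, y). F x y)"
    by (rule lborel_pair.Fubini_integrable) (use i1 i2 in \<open>simp_all add: split_beta'\<close>)
  have "(LINT x|lborel. conv k f x * h x) = (LINT x|lborel. LINT y|lborel. F x y)"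
    by (simp add: F_def conv_def)
  also have "\<dots> = (LINT y|lborel. LINT x|lborel. F x y)"
    using lborel_pair.Fubini_integral[OF iF] by simp
  also have "\<dots> = (LINT y|lborel. conv (\<lambda>z. k (- z)) h y * f y)"
  proof (rule arg_cong[where f="integral\<^sup>L lborel"], rule ext)
    fix y
    have "(LINT x|lborel. F x y) = (LINT x|lborel. k (x - y) * h x * f y)"
      by (simp add: F_def mult.assoc mult.commute[of "f y"])
    also have "\<dots> = conv (\<lambda>z. k (- z)) h y * f y"
      by (simp add: conv_def)
    finally show "(LINT x|lborel. F x y) = conv (\<lambda>z. k (- z)) h y * f y" .
  qed
  finally show ?thesis .
qed

section \<open>Completeness and compactness\<close>

lemma Lp_Fatou:
  assumes p: "0 < p" and c: "0 \<le> c" and v: "\<And>n. Lp_mem p (v n)" and le: "\<And>n. nrm p (v n) \<le> c"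
    and w [measurable]: "w \<in> borel_measurable borel" and lim: "AE x in lborel. (\<lambda>n. v n x) \<longlonglongrightarrow> w x"
  shows "Lp_mem p w" "nrm p w \<le> c"
proof -
  note [measurable] = Lp_mem_measurable[OF v]
  have "(\<integral>\<^sup>+x. ennreal (norm (w x) powr p) \<partial>lborel) = (\<integral>\<^sup>+x. liminf (\<lambda>n. ennreal (norm (v n x) powr p)) \<partial>lborel)"
  proof (rule nn_integral_cong_AE)
    show "AE x in lborel. ennreal (norm (w x) powr p) = liminf (\<lambda>n. ennreal (norm (v n x) powr p))"
      using lim
    proof eventually_elim
      case (elim x)
      have "(\<lambda>n. norm (v n x) powr p) \<longlonglongrightarrow> norm (w x) powr p"
        by (rule tendsto_powr') (use elim p in \<open>auto intro!: tendsto_intros\<close>)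
      then have "(\<lambda>n. ennreal (norm (v n x) powr p)) \<longlonglongrightarrow> ennreal (norm (w x) powr p)"
        by (rule tendsto_ennrealI)
      then show ?case by (simp only: lim_imp_Liminf[OF sequentially_bot])
    qed
  qed
  also have "\<dots> \<le> liminf (\<lambda>n. \<integral>\<^sup>+x. ennreal (norm (v n x) powr p) \<partial>lborel)"
    by (rule nn_integral_liminf) auto
  also have "\<dots> \<le> liminf (\<lambda>n::nat. ennreal (c powr p))"
  proof (intro Liminf_mono always_eventually allI)
    fix n
    have "(LINT x|lborel. norm (v n x) powr p) \<le> c powr p"
      using le[of n] by (subst (asm) nrm_le_iff) (use p c in auto)
    then show "(\<integral>\<^sup>+x. ennreal (norm (v n x) powr p) \<partial>lborel) \<le> ennreal (c powr p)"
      using v[of n] by (subst nn_integral_eq_integral) (auto simp: Lp_mem_def)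
  qed
  also have "\<dots> = ennreal (c powr p)" by (simp add: Liminf_const)
  finally have le: "(\<integral>\<^sup>+x. ennreal (norm (w x) powr p) \<partial>lborel) \<le> ennreal (c powr p)" .
  then have int: "integrable lborel (\<lambda>x. norm (w x) powr p)"
    by (intro integrableI_nonneg) (auto intro: le_less_trans)
  then show "Lp_mem p w" by (simp add: Lp_mem_def)
  show "nrm p w \<le> c"
    using le p c int by (subst nrm_le_iff) (auto simp: nn_integral_eq_integral)
qed

lemma Lp_dominated_convergence:
  assumes p: "0 < p" and w: "Lp_mem p w" and u [measurable]: "\<And>n. u n \<in> borel_measurable borel"
    and le: "\<And>n. AE x in lborel. norm (u n x) \<le> norm (w x)"
    and G [measurable]: "G \<in> borel_measurable borel" and lim: "AE x in lborel. (\<lambda>n. u n x) \<longlonglongrightarrow> G x"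
  shows "\<And>n. Lp_mem p (u n)" "Lp_mem p G" "(\<lambda>n. nrm p (\<lambda>x. u n x - G x)) \<longlonglongrightarrow> 0"
proof -
  note [measurable] = Lp_mem_measurable[OF w]
  have iw: "integrable lborel (\<lambda>x. norm (w x) powr p)" using w by (simp add: Lp_mem_def)
  show mu: "Lp_mem p (u n)" for n
    using Lp_mem_dominated(1)[OF p _ w u, of 1] le by simp
  have allle: "AE x in lborel. \<forall>n. norm (u n x) \<le> norm (w x)"
    using le by (simp add: AE_all_countable)
  have leG: "AE x in lborel. norm (G x) \<le> norm (w x)"
    using lim allle
  proof eventually_elim
    case (elim x)
    then show ?case by (intro tendsto_upperbound[OF tendsto_norm[OF elim(1)]]) auto
  qed
  then show mG: "Lp_mem p G"
    using Lp_mem_dominated(1)[OF p _ w G, of 1] by simp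
  have "(\<lambda>n. LINT x|lborel. norm (u n x - G x) powr p) \<longlonglongrightarrow> (LINT x::'a|lborel. 0)"
  proof (rule integral_dominated_convergence)
    show "integrable lborel (\<lambda>x. 2 powr p * norm (w x) powr p)" using iw by simp
    show "AE x in lborel. (\<lambda>n. norm (u n x - G x) powr p) \<longlonglongrightarrow> 0"
      using lim
    proof eventually_elim
      case (elim x)
      have "(\<lambda>n. norm (u n x - G x)) \<longlonglongrightarrow> 0"
        using elim by (simp add: LIM_zero tendsto_norm_zero)
      from tendsto_powr'[OF this tendsto_const[of p]] show ?case using p by simp
    qed
    show "AE x in lborel. norm (norm (u n x - G x) powr p) \<le> 2 powr p * norm (w x) powr p" for n
      using allle leG
    proof eventually_elim
      case (elim x)
      have "norm (u n x - G x) \<le> 2 * norm (w x)"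
        using norm_triangle_ineq4[of "u n x" "G x"] elim(1)[rule_format, of n] elim(2) by linarith
      then have "norm (u n x - G x) powr p \<le> (2 * norm (w x)) powr p"
        using p by (intro powr_mono2) auto
      then show ?case by (simp add: powr_mult)
    qed
  qed auto
  then have "(\<lambda>n. (LINT x|lborel. norm (u n x - G x) powr p) powr (1 / p)) \<longlonglongrightarrow> 0 powr (1 / p)"
    by (intro tendsto_powr') (use p in auto)
  then show "(\<lambda>n. nrm p (\<lambda>x. u n x - G x)) \<longlonglongrightarrow> 0" by (simp add: nrm_def)
qed

lemma fast_Cauchy_subsequence:
  assumes "\<And>e. 0 < e \<Longrightarrow> \<exists>N. \<forall>m\<ge>N. \<forall>n\<ge>N. (D :: nat \<Rightarrow> nat \<Rightarrow> real) m n < e" and "\<And>n. 0 < (e :: nat \<Rightarrow> real) n"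
  obtains \<sigma> where "strict_mono \<sigma>" "\<And>n. D (\<sigma> (Suc n)) (\<sigma> n) < e n"
proof -
  have "\<exists>N. \<forall>m\<ge>N. \<forall>n\<ge>N. D m n < e i" for i using assms by blast
  then obtain N where N: "\<And>i m n. m \<ge> N i \<Longrightarrow> n \<ge> N i \<Longrightarrow> D m n < e i" by metis
  \<comment> \<open>Summing the thresholds dominates each of them, and the added \<open>n\<close>
    makes the sequence strictly increasing.\<close>
  define \<sigma> where "\<sigma> n = (\<Sum>i\<le>n. N i) + n" for n
  have "strict_mono \<sigma>" by (rule strict_monoI_Suc) (simp add: \<sigma>_def)
  moreover have "N n \<le> \<sigma> n" "N n \<le> \<sigma> (Suc n)" for n
    unfolding \<sigma>_def using member_le_sum[of n "{..n}" N] by auto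
  ultimately show thesis using that N by blast
qed

theorem Riesz_Fischer:
  assumes p: "0 < p" and u: "\<And>n. Lp_mem p (u n)"
    and Cauchy: "\<And>e. 0 < e \<Longrightarrow> \<exists>N. \<forall>m\<ge>N. \<forall>n\<ge>N. nrm p (\<lambda>x. u m x - u n x) < e"
  obtains g where "Lp_mem p g" "(\<lambda>n. nrm p (\<lambda>x. u n x - g x)) \<longlonglongrightarrow> 0"
proof -
  note [measurable] = Lp_mem_measurable[OF u]
  obtain \<sigma> where \<sigma>: "strict_mono \<sigma>" and fast: "\<And>n. nrm p (\<lambda>x. u (\<sigma> (Suc n)) x - u (\<sigma> n) x) < (1/4)^n"
    by (rule fast_Cauchy_subsequence[where D = "\<lambda>m n. nrm p (\<lambda>x. u m x - u n x)" and e = "\<lambda>n. (1/4)^n"])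
      (use Cauchy in auto)
  define \<Delta> where "\<Delta> n x = u (\<sigma> (Suc n)) x - u (\<sigma> n) x" for n x
  have [measurable]: "\<Delta> n \<in> borel_measurable borel" for n unfolding \<Delta>_def[abs_def] by measurable
  have m\<Delta>: "Lp_mem p (\<Delta> n)" for n unfolding \<Delta>_def[abs_def] by (rule Lp_mem_diff[OF p u u])
  define S where "S x = (\<Sum>n. ennreal ((2^n * norm (\<Delta> n x)) powr p))" for x
  have "(\<integral>\<^sup>+x. S x \<partial>lborel) = (\<Sum>n. \<integral>\<^sup>+x. ennreal ((2^n * norm (\<Delta> n x)) powr p) \<partial>lborel)"
    unfolding S_def by (rule nn_integral_suminf) measurable
  also have "\<dots> \<le> (\<Sum>n. ennreal (((1/2) powr p)^n))"
  proof (rule suminf_le)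
    fix n
    have i: "integrable lborel (\<lambda>x. norm (\<Delta> n x) powr p)" using m\<Delta> by (simp add: Lp_mem_def)
    have "(LINT x|lborel. (2^n * norm (\<Delta> n x)) powr p) = (2^n) powr p * nrm p (\<Delta> n) powr p"
      using p by (simp add: powr_mult nrm_powr)
    also have "\<dots> \<le> (2^n) powr p * ((1/4)^n) powr p"
      using fast[of n] p by (intro mult_left_mono powr_mono2) (auto simp: \<Delta>_def[abs_def])
    also have "\<dots> = ((1/2)^n) powr p" by (simp flip: powr_mult power_mult_distrib)
    also have "\<dots> = ((1/2) powr p)^n"
    proof -
      have "((1/2::real)^n) powr p = ((1/2) powr real n) powr p" by (subst powr_realpow) auto
      also have "\<dots> = ((1/2) powr p) powr real n" by (simp add: powr_powr mult.commute)
      also have "\<dots> = ((1/2) powr p)^n" by (subst powr_realpow) auto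
      finally show ?thesis .
    qed
    finally show "(\<integral>\<^sup>+x. ennreal ((2^n * norm (\<Delta> n x)) powr p) \<partial>lborel) \<le> ennreal (((1/2) powr p)^n)"
      using i by (subst nn_integral_eq_integral) (auto simp: powr_mult)
  qed auto
  also have "\<dots> < \<infinity>"
  proof -
    have "(1/2::real) powr p < 1 powr p" using p by (intro powr_less_mono2) auto
    then have "summable (\<lambda>n. ((1/2::real) powr p)^n)" by (intro summable_geometric) auto
    then show ?thesis by (subst suminf_ennreal2) auto
  qed
  finally have "AE x in lborel. S x \<noteq> \<infinity>"
    by (intro nn_integral_PInf_AE) (auto simp: S_def[abs_def])
  then have conv: "AE x in lborel. convergent (\<lambda>n. u (\<sigma> n) x)"
  proof eventually_elim
    case (elim x)
    define c where "c = enn2real (S x)"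
    have c: "ennreal c = S x" using elim by (simp add: c_def less_top)
    have "norm (\<Delta> n x) \<le> c powr (1 / p) * (1/2)^n" for n
    proof -
      have "(\<Sum>i\<in>{n}. ennreal ((2^i * norm (\<Delta> i x)) powr p)) \<le> S x"
        unfolding S_def by (rule sum_le_suminf[OF summableI]) simp_all
      then have "ennreal ((2^n * norm (\<Delta> n x)) powr p) \<le> S x" by simp
      then have "(2^n * norm (\<Delta> n x)) powr p \<le> c"
        unfolding c[symmetric] by (subst (asm) ennreal_le_iff) (auto simp: c_def)
      then have "((2^n * norm (\<Delta> n x)) powr p) powr (1 / p) \<le> c powr (1 / p)"
        using p by (intro powr_mono2) auto
      then show ?thesis using p by (simp add: powr_powr field_simps)
    qed
    then have "summable (\<lambda>n. \<Delta> n x)"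
      by (intro summable_comparison_test'[OF summable_mult[OF summable_geometric[of "1/2::real"]]]) auto
    then have "convergent (\<lambda>n. \<Sum>i<n. \<Delta> i x)" by (simp add: summable_iff_convergent)
    moreover have "(\<Sum>i<n. \<Delta> i x) = u (\<sigma> n) x - u (\<sigma> 0) x" for n
      unfolding \<Delta>_def by (rule sum_lessThan_telescope)
    ultimately have "convergent (\<lambda>n. u (\<sigma> n) x - u (\<sigma> 0) x)" by simp
    then show ?case using convergent_diff_const_right_iff by blast
  qed
  define g where "g x = lim (\<lambda>n. u (\<sigma> n) x)" for x
  have [measurable]: "g \<in> borel_measurable borel" unfolding g_def[abs_def] by measurable
  \<comment> \<open>Fatou along the subsequence compares every late \<open>u n\<close>, not only the
    selected ones, with \<open>g\<close>.\<close>
  have close: "Lp_mem p (\<lambda>x. u n x - g x) \<and> nrm p (\<lambda>x. u n x - g x) \<le> e"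
    if e: "0 < e" and N: "\<forall>m\<ge>N. \<forall>n\<ge>N. nrm p (\<lambda>x. u m x - u n x) < e" and "n \<ge> N" for n N e
  proof -
    have "AE x in lborel. (\<lambda>i. u n x - u (\<sigma> (i + N)) x) \<longlonglongrightarrow> u n x - g x"
      using conv
    proof eventually_elim
      case (elim x)
      then have "(\<lambda>n. u (\<sigma> n) x) \<longlonglongrightarrow> g x" by (simp add: g_def convergent_LIMSEQ_iff)
      then show ?case by (intro tendsto_diff tendsto_const) (rule LIMSEQ_ignore_initial_segment)
    qed
    moreover have "nrm p (\<lambda>x. u n x - u (\<sigma> (i + N)) x) \<le> e" for i
      using N \<open>n \<ge> N\<close> strict_mono_imp_increasing[OF \<sigma>, of "i + N"] by (intro less_imp_le) auto
    ultimately show ?thesis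
      using Lp_Fatou[OF p, of e "\<lambda>i x. u n x - u (\<sigma> (i + N)) x" "\<lambda>x. u n x - g x"] e Lp_mem_diff[OF p u u] by auto
  qed
  show thesis
  proof
    obtain N where "\<forall>m\<ge>N. \<forall>n\<ge>N. nrm p (\<lambda>x. u m x - u n x) < 1" using Cauchy[of 1] by auto
    then have "Lp_mem p (\<lambda>x. u N x - g x)" using close[of 1 N N] by simp
    from Lp_mem_diff[OF p u[of N] this] show "Lp_mem p g" by simp
    show "(\<lambda>n. nrm p (\<lambda>x. u n x - g x)) \<longlonglongrightarrow> 0"
    proof (rule LIMSEQ_I)
      fix e :: real assume "0 < e"
      then obtain N where "\<forall>m\<ge>N. \<forall>n\<ge>N. nrm p (\<lambda>x. u m x - u n x) < e / 2" using Cauchy[of "e/2"] by auto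
      then show "\<exists>N. \<forall>n\<ge>N. norm (nrm p (\<lambda>x. u n x - g x) - 0) < e"
        using close[of "e/2" N] \<open>0 < e\<close> by (intro exI[of _ N]) force
    qed
  qed
qed

section \<open>Compactness in Lebesgue spaces by the Arzela-Ascoli argument\<close>

lemma Lp_mem_indicator_cball:
  assumes "0 < p"
  shows "Lp_mem p (\<lambda>y. c * indicator (cball x R) y)"
proof -
  have "integrable lborel (indicator (cball x R) :: 'a \<Rightarrow> real)"
    by (simp add: integrable_indicator_iff emeasure_lborel_cball_finite[unfolded infinity_ennreal_def])
  moreover have "norm (indicator (cball x R) y :: complex) powr p = indicator (cball x R) y" for y
    by (auto simp: indicator_def)
  ultimately have "Lp_mem p (\<lambda>y. indicator (cball x R) y)"
    by (simp add: Lp_mem_def) (intro borel_measurable_indicator, simp)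
  then show ?thesis by (rule Lp_mem_cmult[OF assms])
qed

text \<open>A common bound and a common ball together provide one integrable majorant, a multiple of
  the indicator of the ball.\<close>

definition equibounded_support :: "(nat \<Rightarrow> 'a::euclidean_space \<Rightarrow> complex) \<Rightarrow> bool" where
  "equibounded_support u \<longleftrightarrow> (\<exists>B R. \<forall>n x. norm (u n x) \<le> B \<and> (R < norm x \<longrightarrow> u n x = 0))"

text \<open>Here \<open>d\<close> may depend on \<open>x\<close> but not on \<open>n\<close>; this
  is enough, since only pointwise convergence is extracted from it.\<close>

definition equicontinuous :: "(nat \<Rightarrow> 'a::euclidean_space \<Rightarrow> complex) \<Rightarrow> bool" where
  "equicontinuous u \<longleftrightarrow> (\<forall>x. \<forall>e>0. \<exists>d>0. \<forall>n y. norm (x - y) < d \<longrightarrow> norm (u n x - u n y) < e)"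

lemma equicontinuous_measurable:
  assumes "equicontinuous u"
  shows "u n \<in> borel_measurable borel"
proof (intro borel_measurable_continuous_onI continuous_at_imp_continuous_on ballI)
  fix x
  show "isCont (u n) x"
    unfolding continuous_at_eps_delta
  proof (intro allI impI)
    fix e :: real assume "0 < e"
    then obtain d where "0 < d" "\<And>y. norm (x - y) < d \<Longrightarrow> norm (u n x - u n y) < e"
      using assms unfolding equicontinuous_def by blast
    then show "\<exists>d>0. \<forall>y. dist y x < d \<longrightarrow> dist (u n y) (u n x) < e"
      by (auto simp: dist_norm norm_minus_commute intro!: exI[of _ d])
  qed
qed

text \<open>Along one subsequence all approximating families converge on a countable dense set, by
  equicontinuity everywhere, and by dominated convergence in norm. As the families approximate
  \<open>v\<close> arbitrarily well, \<open>v\<close> is Cauchy along that subsequence, and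
  completeness supplies the limit.\<close>

lemma Lp_precompact:
  assumes s: "1 \<le> s" and v: "\<And>n. Lp_mem s (v n)"
    and approx: "\<And>e. 0 < e \<Longrightarrow> \<exists>u N. equibounded_support u \<and> equicontinuous u \<and>
      (\<forall>n\<ge>N. nrm s (\<lambda>x. v n x - u n x) \<le> e)"
  obtains \<sigma> :: "nat \<Rightarrow> nat" and g where "strict_mono \<sigma>" "Lp_mem s g" "(\<lambda>n. nrm s (\<lambda>x. v (\<sigma> n) x - g x)) \<longlonglongrightarrow> 0"
proof -
  have s0: "0 < s" using s by simp
  have "\<exists>u N. equibounded_support u \<and> equicontinuous u \<and>
      (\<forall>n\<ge>N. nrm s (\<lambda>x. v n x - u n x) \<le> 1 / real (Suc j))" for j
    by (rule approx) simp
  then obtain u N where bd: "\<And>j. equibounded_support (u j)" and eq: "\<And>j. equicontinuous (u j)"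
    and close: "\<And>j n. n \<ge> N j \<Longrightarrow> nrm s (\<lambda>x. v n x - u j n x) \<le> 1 / real (Suc j)"
    by metis
  \<comment> \<open>Dividing by the bound makes the functions for all \<open>j\<close> uniformly bounded, so that one extraction serves every \<open>j\<close>.\<close>
  from bd obtain B R where B: "\<And>j n x. norm (u j n x) \<le> B j" and R: "\<And>j n x. R j < norm x \<Longrightarrow> u j n x = 0"
    unfolding equibounded_support_def by metis
  have B0: "0 \<le> B j" for j using B[of j 0 0] norm_ge_zero order_trans by blast
  note [measurable] = equicontinuous_measurable[OF eq]
  obtain D :: "'a set" where D: "countable D" "\<And>X. open X \<Longrightarrow> X \<noteq> {} \<Longrightarrow> \<exists>d\<in>D. d \<in> X"
    using countable_dense_setE by blast
  have "norm (u (fst z) n (snd z) / of_real (B (fst z) + 1)) \<le> 1" for z n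
  proof -
    have "norm (u (fst z) n (snd z)) / (B (fst z) + 1) \<le> 1"
      using B[of "fst z" n "snd z"] B0[of "fst z"] by simp
    moreover have "norm (complex_of_real (B (fst z) + 1)) = B (fst z) + 1"
      unfolding norm_of_real using B0[of "fst z"] by simp
    ultimately show ?thesis by (simp only: norm_divide)
  qed
  note bound = this
  have "countable ((UNIV :: nat set) \<times> D)" using D(1) by auto
  from function_convergent_subsequence[of "UNIV \<times> D" "\<lambda>n z. u (fst z) n (snd z) / of_real (B (fst z) + 1)" 1, OF this bound]
  obtain \<sigma> :: "nat \<Rightarrow> nat" where \<sigma>: "strict_mono \<sigma>"
    and lim: "\<And>z. z \<in> UNIV \<times> D \<Longrightarrow> \<exists>l. (\<lambda>n. u (fst z) (\<sigma> n) (snd z) / of_real (B (fst z) + 1)) \<longlonglongrightarrow> l"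
    by blast
  have convD: "convergent (\<lambda>n. u j (\<sigma> n) d)" if d: "d \<in> D" for j d
  proof -
    obtain l where l: "(\<lambda>n. u j (\<sigma> n) d / of_real (B j + 1)) \<longlonglongrightarrow> l" using lim[of "(j, d)"] d by auto
    have ne: "complex_of_real (B j + 1) \<noteq> 0" unfolding of_real_eq_0_iff using B0[of j] by linarith
    have "(\<lambda>n. of_real (B j + 1) * (u j (\<sigma> n) d / of_real (B j + 1))) \<longlonglongrightarrow> of_real (B j + 1) * l"
      by (rule tendsto_mult_left[OF l])
    then show ?thesis unfolding convergent_def using ne by (auto simp del: of_real_add)
  qed
  have conv: "convergent (\<lambda>n. u j (\<sigma> n) x)" for j x
  proof (rule Cauchy_convergent, rule metric_CauchyI)
    fix e :: real assume "0 < e"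
    then obtain \<delta> where \<delta>: "0 < \<delta>" "\<And>n y. norm (x - y) < \<delta> \<Longrightarrow> norm (u j n x - u j n y) < e / 3"
      using eq[of j] unfolding equicontinuous_def by (metis zero_less_divide_iff zero_less_numeral)
    obtain d where d: "d \<in> D" "d \<in> ball x \<delta>" using D(2)[of "ball x \<delta>"] \<delta>(1) by auto
    have "Cauchy (\<lambda>n. u j (\<sigma> n) d)" using convD[OF d(1)] by (simp add: convergent_Cauchy)
    then obtain M where M: "\<And>m n. m \<ge> M \<Longrightarrow> n \<ge> M \<Longrightarrow> dist (u j (\<sigma> m) d) (u j (\<sigma> n) d) < e / 3"
      using metric_CauchyD[of "\<lambda>n. u j (\<sigma> n) d" "e / 3"] \<open>0 < e\<close> by auto
    have n3: "dist (u j n x) (u j n d) < e / 3" for n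
      using \<delta>(2)[of d n] d(2) by (simp add: dist_norm)
    show "\<exists>M. \<forall>m\<ge>M. \<forall>n\<ge>M. dist (u j (\<sigma> m) x) (u j (\<sigma> n) x) < e"
    proof (intro exI[of _ M] allI impI)
      fix m n assume "m \<ge> M" "n \<ge> M"
      then show "dist (u j (\<sigma> m) x) (u j (\<sigma> n) x) < e"
        using M[of m n] n3[of "\<sigma> m"] n3[of "\<sigma> n"]
          dist_triangle[of "u j (\<sigma> m) x" "u j (\<sigma> n) x" "u j (\<sigma> m) d"]
          dist_triangle[of "u j (\<sigma> m) d" "u j (\<sigma> n) x" "u j (\<sigma> n) d"]
          dist_commute[of "u j (\<sigma> n) x" "u j (\<sigma> n) d"] by linarith
    qed
  qed
  define G where "G j x = lim (\<lambda>n. u j (\<sigma> n) x)" for j x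
  have [measurable]: "G j \<in> borel_measurable borel" for j unfolding G_def[abs_def] by measurable
  have dom: "norm (u j n x) \<le> norm (of_real (B j) * indicator (cball 0 (R j)) x :: complex)" for j n x
    using B[of j n x] R[of j x n] B0[of j] by (auto simp: indicator_def norm_mult)
  note LDC = Lp_dominated_convergence[OF s0 Lp_mem_indicator_cball[OF s0, of "of_real (B j)" 0 "R j" for j]]
  have mu: "Lp_mem s (u j n)" for j n
    by (rule Lp_mem_dominated(1)[OF s0 zero_le_one Lp_mem_indicator_cball[OF s0, of "of_real (B j)" 0 "R j"]])
      (use dom in auto)
  have limG: "(\<lambda>n. u j (\<sigma> n) x) \<longlonglongrightarrow> G j x" for j x
    using conv by (simp add: G_def convergent_LIMSEQ_iff)
  have mG: "Lp_mem s (G j)" and toG: "(\<lambda>n. nrm s (\<lambda>x. u j (\<sigma> n) x - G j x)) \<longlonglongrightarrow> 0" for j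
    by (rule LDC(2,3)[where u = "\<lambda>n. u j (\<sigma> n)" and G = "G j" for j]; use dom limG in auto)+
  have "\<exists>M. \<forall>m\<ge>M. \<forall>n\<ge>M. nrm s (\<lambda>x. v (\<sigma> m) x - v (\<sigma> n) x) < e" if "0 < e" for e
  proof -
    obtain j where j: "1 / real (Suc j) < e / 4"
      using \<open>0 < e\<close> reals_Archimedean[of "e / 4"] by (auto simp: inverse_eq_divide)
    obtain M where M: "\<And>n. n \<ge> M \<Longrightarrow> nrm s (\<lambda>x. u j (\<sigma> n) x - G j x) < e / 4"
      using LIMSEQ_D[OF toG[of j], of "e / 4"] \<open>0 < e\<close> by auto
    have near: "nrm s (\<lambda>x. v (\<sigma> n) x - G j x) < e / 2" if n: "n \<ge> max M (N j)" for n
    proof -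
      have "nrm s (\<lambda>x. v (\<sigma> n) x - u j (\<sigma> n) x) \<le> 1 / real (Suc j)"
        using n strict_mono_imp_increasing[OF \<sigma>, of n] by (intro close) auto
      moreover have "nrm s (\<lambda>x. (v (\<sigma> n) x - u j (\<sigma> n) x) + (u j (\<sigma> n) x - G j x))
          \<le> nrm s (\<lambda>x. v (\<sigma> n) x - u j (\<sigma> n) x) + nrm s (\<lambda>x. u j (\<sigma> n) x - G j x)"
        by (rule nrm_triangle[OF s Lp_mem_diff[OF s0 v mu] Lp_mem_diff[OF s0 mu mG]])
      ultimately show ?thesis using M[of n] n j by simp
    qed
    show ?thesis
    proof (intro exI[of _ "max M (N j)"] allI impI)
      fix m n assume mn: "m \<ge> max M (N j)" "n \<ge> max M (N j)"
      have "nrm s (\<lambda>x. (v (\<sigma> m) x - G j x) + (G j x - v (\<sigma> n) x))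
          \<le> nrm s (\<lambda>x. v (\<sigma> m) x - G j x) + nrm s (\<lambda>x. G j x - v (\<sigma> n) x)"
        by (rule nrm_triangle[OF s Lp_mem_diff[OF s0 v mG] Lp_mem_diff[OF s0 mG v]])
      then show "nrm s (\<lambda>x. v (\<sigma> m) x - v (\<sigma> n) x) < e"
        using near[OF mn(1)] near[OF mn(2)] nrm_minus_commute[of s "G j" "v (\<sigma> n)"] by simp
    qed
  qed
  then obtain g where "Lp_mem s g" "(\<lambda>n. nrm s (\<lambda>x. v (\<sigma> n) x - g x)) \<longlonglongrightarrow> 0"
    using Riesz_Fischer[OF s0, of "\<lambda>n. v (\<sigma> n)"] v by blast
  then show thesis using that \<sigma> by blast
qed

section \<open>Approximation of the kernel\<close>

text \<open>Cutting to where both the modulus and the argument are at most \<open>n\<close>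
  converges in norm by dominated convergence. Bounded support is what separates images of distant
  pieces; boundedness is used for the approximation by continuous functions.\<close>

lemma Lp_truncation:
  assumes p: "0 < p" and k: "Lp_mem p k" and e: "0 < e"
  obtains A B R where "A \<in> sets borel" "0 < B" "0 < R" "\<And>x. x \<in> A \<Longrightarrow> norm (k x) \<le> B \<and> norm x \<le> R"
    "nrm p (\<lambda>x. k x - indicator A x * k x) < e"
proof -
  note [measurable] = Lp_mem_measurable[OF k]
  define A where "A n = {x. norm (k x) \<le> real n \<and> norm x \<le> real n}" for n
  have [measurable]: "A n \<in> sets borel" for n unfolding A_def by measurable
  have "(\<lambda>n. nrm p (\<lambda>x. indicator (A n) x * k x - k x)) \<longlonglongrightarrow> 0"
  proof (rule Lp_dominated_convergence(3)[OF p k])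
    show "AE x in lborel. (\<lambda>n. indicator (A n) x * k x) \<longlonglongrightarrow> k x"
    proof (rule AE_I2)
      fix x
      obtain N where N: "max (norm (k x)) (norm x) \<le> real N" using real_arch_simple by blast
      have "eventually (\<lambda>n. indicator (A n) x * k x = k x) sequentially"
        using eventually_ge_at_top[of N]
      proof eventually_elim
        case (elim n)
        then have "real N \<le> real n" by simp
        then show ?case using N by (auto simp: A_def)
      qed
      then show "(\<lambda>n. indicator (A n) x * k x) \<longlonglongrightarrow> k x"
        by (rule tendsto_eventually)
    qed
  qed (auto simp: indicator_def)
  then have "\<exists>N. \<forall>n\<ge>N. nrm p (\<lambda>x. indicator (A n) x * k x - k x) < e"
    using LIMSEQ_D[of _ 0 e] e by fastforce
  then obtain N where N: "\<And>n. n \<ge> N \<Longrightarrow> nrm p (\<lambda>x. indicator (A n) x * k x - k x) < e" by blast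
  show thesis
  \<comment> \<open>\<open>Suc N\<close> instead of \<open>N\<close> makes both bounds
    positive.\<close>
  proof (rule that[of "A (Suc N)" "real (Suc N)" "real (Suc N)"])
    show "nrm p (\<lambda>x. k x - indicator (A (Suc N)) x * k x) < e"
      using N[of "Suc N"] by (subst nrm_minus_commute) simp
  qed (auto simp: A_def)
qed

text \<open>A measurable function is an almost everywhere limit of continuous ones. Clipping their
  values and cutting off their supports keeps continuity and the limit and adds a fixed majorant, so
  the convergence also holds in norm.\<close>

lemma Lp_Cc_dense:
  fixes k :: "'a::euclidean_space \<Rightarrow> complex"
  assumes p: "1 \<le> p" and k: "Lp_mem p k" and e: "0 < e"
  obtains k' R where "continuous_on UNIV k'" "\<And>x. R < norm x \<Longrightarrow> k' x = 0" "Lp_mem p k'"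
    "nrm p (\<lambda>x. k x - k' x) < e"
proof -
  have p0: "0 < p" using p by simp
  note [measurable] = Lp_mem_measurable[OF k]
  obtain A B R where A [measurable]: "A \<in> sets borel" and B: "0 < B" and R: "0 < R"
    and AB: "\<And>x. x \<in> A \<Longrightarrow> norm (k x) \<le> B \<and> norm x \<le> R"
    and close: "nrm p (\<lambda>x. k x - indicator A x * k x) < e / 2"
    using Lp_truncation[OF p0 k, of "e / 2"] e by auto
  let ?k = "\<lambda>x. indicator A x * k x"
  have mk: "Lp_mem p ?k" by (rule Lp_mem_restrict(1)[OF p0 k A])
  have kb: "norm (?k x) \<le> B" and ks: "R < norm x \<Longrightarrow> ?k x = 0" for x
    using AB[of x] B by (auto simp: indicator_def)
  have "?k \<in> borel_measurable lebesgue" by (intro measurable_completion) measurable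
  then have "?k measurable_on UNIV" by (rule lebesgue_measurable_imp_measurable_on) simp
  then obtain N g where N: "negligible N" and g: "\<And>n. continuous_on UNIV (g n)"
    and lim: "\<And>x. x \<notin> N \<Longrightarrow> (\<lambda>n. g n x) \<longlonglongrightarrow> ?k x"
    unfolding measurable_on_def by auto
  \<comment> \<open>\<open>\<phi>\<close> is 1 on the ball of radius \<open>R\<close> and 0 beyond
    \<open>R + 1\<close>; \<open>clip\<close> is the radial retraction onto the disc of radius
    \<open>B\<close>. Neither changes the truncated function \<open>?k\<close>.\<close>
  define \<phi> where "\<phi> x = max 0 (min 1 (R + 1 - norm x))" for x :: 'a
  define clip where "clip z = complex_of_real (B / max B (norm z)) * z" for z
  define c where "c n x = of_real (\<phi> x) * clip (g n x)" for n x
  have max_pos: "0 < max B (norm z)" for z :: complex using B by simp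
  have clip_cont: "continuous_on UNIV clip"
    unfolding clip_def by (intro continuous_intros) (metis max_pos less_irrefl)
  have clip_norm: "norm (clip z) \<le> B" for z
  proof -
    have "norm (clip z) = B * (norm z / max B (norm z))"
      unfolding clip_def norm_mult norm_of_real using B by simp
    also have "\<dots> \<le> B * 1" using B by (intro mult_left_mono) (auto simp: divide_le_eq max_def)
    finally show ?thesis by simp
  qed
  have clip_id: "clip z = z" if "norm z \<le> B" for z
    using that B by (simp add: clip_def max_def)
  have cont: "continuous_on UNIV (c n)" for n
    unfolding c_def[abs_def] \<phi>_def
    by (intro continuous_intros continuous_on_compose2[OF clip_cont g]) auto
  have [measurable]: "c n \<in> borel_measurable borel" for n
    by (rule borel_measurable_continuous_onI[OF cont])
  have \<phi>: "0 \<le> \<phi> x" "\<phi> x \<le> 1" "norm x \<le> R \<Longrightarrow> \<phi> x = 1" "R + 1 < norm x \<Longrightarrow> \<phi> x = 0" for x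
    by (auto simp: \<phi>_def)
  have bound: "norm (c n x) \<le> norm (of_real B * indicator (cball 0 (R + 1)) x :: complex)" for n x
  proof (cases "R + 1 < norm x")
    case False
    have "norm (c n x) \<le> 1 * B"
      unfolding c_def norm_mult using \<phi>(1,2)[of x] clip_norm B by (intro mult_mono) auto
    then show ?thesis using False B by (simp add: norm_mult)
  qed (simp add: c_def \<phi>)
  have ae: "AE x in lborel. (\<lambda>n. c n x) \<longlonglongrightarrow> ?k x"
  proof -
    have "AE x in lebesgue. x \<notin> N" using N by (intro AE_not_in) (simp add: negligible_iff_null_sets)
    then have "AE x in lborel. x \<notin> N" by (simp add: AE_completion_iff)
    then show ?thesis
    proof eventually_elim
      case (elim x)
      have "isCont clip (?k x)" using clip_cont by (simp add: continuous_on_eq_continuous_at)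
      then have "(\<lambda>n. clip (g n x)) \<longlonglongrightarrow> clip (?k x)" by (rule isCont_tendsto_compose) (rule lim[OF elim])
      then have "(\<lambda>n. c n x) \<longlonglongrightarrow> of_real (\<phi> x) * clip (?k x)"
        unfolding c_def by (rule tendsto_mult_left)
      moreover have "of_real (\<phi> x) * clip (?k x) = ?k x"
        using clip_id[OF kb] \<phi>(3)[of x] ks[of x] by (cases "R < norm x") auto
      ultimately show ?case by simp
    qed
  qed
  note LDC = Lp_dominated_convergence[OF p0 Lp_mem_indicator_cball[OF p0, of "of_real B" 0 "R + 1"], of c ?k]
  have mc: "Lp_mem p (c n)" for n by (rule LDC(1)) (use bound ae in auto)
  have "(\<lambda>n. nrm p (\<lambda>x. c n x - ?k x)) \<longlonglongrightarrow> 0" by (rule LDC(3)) (use bound ae in auto)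
  from LIMSEQ_D[OF this, of "e / 2"] obtain M where "nrm p (\<lambda>x. c M x - ?k x) < e / 2"
    using e by auto
  then have "nrm p (\<lambda>x. ?k x - c M x) < e / 2" by (subst nrm_minus_commute)
  moreover have "nrm p (\<lambda>x. (k x - ?k x) + (?k x - c M x)) \<le> nrm p (\<lambda>x. k x - ?k x) + nrm p (\<lambda>x. ?k x - c M x)"
    by (rule nrm_triangle[OF p Lp_mem_diff[OF p0 k mk] Lp_mem_diff[OF p0 mk mc]])
  ultimately have "nrm p (\<lambda>x. k x - c M x) < e" using close by simp
  then show thesis
    using that[of "c M" "R + 1"] cont mc \<phi>(4) by (auto simp: c_def)
qed

text \<open>With \<open>d \<le> 1\<close> and the compact ball of radius \<open>R + 1\<close>, two
  close points either both lie in that ball or both lie outside the ball of radius \<open>R\<close>,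
  where the function vanishes.\<close>

lemma Cc_uniformly_continuous:
  fixes k :: "'a::euclidean_space \<Rightarrow> complex"
  assumes cont: "continuous_on UNIV k" and supp: "\<And>x. R < norm x \<Longrightarrow> k x = 0" and e: "0 < e"
  obtains d where "0 < d" "d \<le> 1" "\<And>x y. norm (x - y) < d \<Longrightarrow> norm (k x - k y) < e"
proof -
  have "uniformly_continuous_on (cball 0 (R + 1)) k"
    by (intro compact_uniformly_continuous continuous_on_subset[OF cont]) auto
  then obtain d where d: "0 < d" "\<And>x y. x \<in> cball 0 (R + 1) \<Longrightarrow> y \<in> cball 0 (R + 1) \<Longrightarrow> dist y x < d \<Longrightarrow> dist (k y) (k x) < e"
    using e unfolding uniformly_continuous_on_def by metis
  show thesis
  proof (rule that[of "min d 1"])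
    fix x y :: 'a assume xy: "norm (x - y) < min d 1"
    show "norm (k x - k y) < e"
    proof (cases "norm x \<le> R + 1 \<and> norm y \<le> R + 1")
      case True
      then show ?thesis using d(2)[of y x] xy by (simp add: dist_norm)
    next
      case False
      have "\<bar>norm x - norm y\<bar> \<le> norm (x - y)" by (rule norm_triangle_ineq3)
      then have "R < norm x" "R < norm y" using False xy by auto
      then show ?thesis using supp e by simp
    qed
  qed (use d in auto)
qed

text \<open>Hoelder puts all dependence on \<open>x\<close> into translates of \<open>k\<close>
  measured in the dual exponent, so the estimates are uniform over the unit ball of the
  \<open>f n\<close>.\<close>

lemma conv_Cc_compact:
  fixes k :: "'a::euclidean_space \<Rightarrow> complex"
  assumes p: "1 < p" and cont: "continuous_on UNIV k" and supp: "\<And>x. R < norm x \<Longrightarrow> k x = 0"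
    and f: "\<And>n. Lp_mem p (f n)" and f1: "\<And>n. nrm p (f n) \<le> 1" and f0: "\<And>n x. R' < norm x \<Longrightarrow> f n x = 0"
  shows "equibounded_support (\<lambda>n. conv k (f n))" "equicontinuous (\<lambda>n. conv k (f n))"
proof -
  define p' where "p' = p / (p - 1)"
  have p': "1 < p'" "1 / p' + 1 / p = 1" using p by (auto simp: p'_def field_simps)
  have p'0: "0 < p'" using p' by simp
  have [measurable]: "k \<in> borel_measurable borel" by (rule borel_measurable_continuous_onI[OF cont])
  have "compact (k ` cball 0 R)" by (intro compact_continuous_image continuous_on_subset[OF cont]) auto
  then obtain B where B: "\<And>x. x \<in> cball 0 R \<Longrightarrow> norm (k x) \<le> B" by (meson bounded_iff compact_imp_bounded image_eqI)
  have kB: "norm (k x) \<le> norm (of_real \<bar>B\<bar> * indicator (cball 0 R) x :: complex)" for x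
    using B[of x] supp[of x] by (auto simp: indicator_def norm_mult)
  have mk: "Lp_mem p' k"
    by (rule Lp_mem_dominated(1)[OF p'0 zero_le_one Lp_mem_indicator_cball[OF p'0, of "of_real \<bar>B\<bar>" 0 R]]) (use kB in auto)
  have mkx: "Lp_mem p' (\<lambda>y. k (x - y))" and nkx: "nrm p' (\<lambda>y. k (x - y)) = nrm p' k" for x
    using Lp_reflect[OF mk] by auto
  have bound: "norm (conv k (f n) x) \<le> nrm p' k" for n x
  proof -
    have "norm (conv k (f n) x) \<le> nrm p' (\<lambda>y. k (x - y)) * nrm p (f n)"
      unfolding conv_def by (rule Holder(3)[OF p'(1) p p'(2) mkx f])
    also have "\<dots> \<le> nrm p' k * 1" unfolding nkx using f1 by (intro mult_left_mono) auto
    finally show ?thesis by simp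
  qed
  have zero: "conv k (f n) x = 0" if x: "R + R' < norm x" for n x
  proof -
    have "k (x - y) * f n y = 0" for y
    proof (cases "R' < norm y")
      case False
      then have "R < norm (x - y)" using x norm_triangle_ineq2[of x y] by linarith
      then show ?thesis using supp by simp
    qed (simp add: f0)
    then have "(\<lambda>y. k (x - y) * f n y) = (\<lambda>_. 0)" by blast
    then show ?thesis by (simp add: conv_def)
  qed
  show "equibounded_support (\<lambda>n. conv k (f n))"
    unfolding equibounded_support_def using bound zero by blast
  show "equicontinuous (\<lambda>n. conv k (f n))"
    unfolding equicontinuous_def
  proof (intro allI impI)
    fix x :: 'a and e :: real assume e: "0 < e"
    let ?I = "\<lambda>y. 1 * indicator (cball x (R + 1)) y :: complex"
    \<comment> \<open>The difference of two nearby translates of \<open>k\<close> lives in the ball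
      around \<open>x\<close> of radius \<open>R + 1\<close>, whose indicator has norm
      \<open>V\<close>. Dividing by \<open>V + 1\<close> is always legitimate and leaves a strict
      inequality.\<close>
    define V where "V = nrm p' ?I"
    have V: "0 \<le> V" by (simp add: V_def)
    have mI: "Lp_mem p' ?I" by (rule Lp_mem_indicator_cball[OF p'0])
    obtain d where d: "0 < d" "d \<le> 1" "\<And>x y. norm (x - y) < d \<Longrightarrow> norm (k x - k y) < e / (V + 1)"
      using Cc_uniformly_continuous[OF cont, of R "e / (V + 1)"] supp e V by auto
    show "\<exists>d>0. \<forall>n y. norm (x - y) < d \<longrightarrow> norm (conv k (f n) x - conv k (f n) y) < e"
    proof (intro exI[of _ d] conjI allI impI)
      fix n y assume xy: "norm (x - y) < d"
      have le: "norm (k (x - z) - k (y - z)) \<le> e / (V + 1) * norm (?I z)" for z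
      proof (cases "z \<in> cball x (R + 1)")
        case True
        then show ?thesis using d(3)[of "x - z" "y - z"] xy by (simp add: less_imp_le)
      next
        case False
        then have 1: "R + 1 < norm (x - z)" by (simp add: dist_norm)
        moreover have "norm (x - z) \<le> norm (x - y) + norm (y - z)"
          using norm_triangle_ineq[of "x - y" "y - z"] by simp
        ultimately have "R < norm (y - z)" using xy d(2) by linarith
        then show ?thesis using 1 supp[of "x - z"] supp[of "y - z"] False by simp
      qed
      have m: "Lp_mem p' (\<lambda>z. k (x - z) - k (y - z))" by (rule Lp_mem_diff[OF p'0 mkx mkx])
      have "nrm p' (\<lambda>z. k (x - z) - k (y - z)) \<le> e / (V + 1) * V"
        unfolding V_def
        by (rule Lp_mem_dominated(2)[OF p'0 _ mI]) (use le e V in \<open>auto simp: V_def\<close>)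
      also have "\<dots> < e" using e V by (simp add: field_simps)
      finally have small: "nrm p' (\<lambda>z. k (x - z) - k (y - z)) < e" .
      have "conv k (f n) x - conv k (f n) y = (LINT z|lborel. (k (x - z) - k (y - z)) * f n z)"
        unfolding conv_def left_diff_distrib
        by (rule Bochner_Integration.integral_diff[symmetric]; rule Holder(1)[OF p'(1) p p'(2) mkx f])
      also have "norm \<dots> \<le> nrm p' (\<lambda>z. k (x - z) - k (y - z)) * nrm p (f n)"
        by (rule Holder(3)[OF p'(1) p p'(2) m f])
      also have "\<dots> \<le> nrm p' (\<lambda>z. k (x - z) - k (y - z)) * 1" using f1 by (intro mult_left_mono) auto
      finally show "norm (conv k (f n) x - conv k (f n) y) < e" using small by simp
    qed (use d in auto)
  qed
qed

section \<open>Tightness of almost maximizing functions\<close>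

text \<open>The mass of a set is the power \<open>p\<close> of the norm of the restriction to it;
  this turns cutting \<open>f\<close> into additivity of a measure.\<close>

definition mass :: "real \<Rightarrow> ('a::euclidean_space \<Rightarrow> complex) \<Rightarrow> 'a measure" where
  "mass p f = density lborel (\<lambda>x. ennreal (norm (f x) powr p))"

lemma sets_mass [simp, measurable_cong]: "sets (mass p f) = sets borel"
  and space_mass [simp]: "space (mass p f) = UNIV"
  by (simp_all add: mass_def)

lemma
  assumes p: "0 < p" and f: "Lp_mem p f" and A: "A \<in> sets borel"
  shows emeasure_mass: "emeasure (mass p f) A = ennreal (nrm p (\<lambda>x. indicator A x * f x) powr p)"
    and measure_mass: "measure (mass p f) A = nrm p (\<lambda>x. indicator A x * f x) powr p"
proof -
  note [measurable] = Lp_mem_measurable[OF f] A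
  have "emeasure (mass p f) A = (\<integral>\<^sup>+x. ennreal (norm (f x) powr p) * indicator A x \<partial>lborel)"
    unfolding mass_def by (rule emeasure_density) auto
  also have "\<dots> = (\<integral>\<^sup>+x. ennreal (norm (indicator A x * f x) powr p) \<partial>lborel)"
    by (intro nn_integral_cong) (auto simp: indicator_def)
  also have "\<dots> = ennreal (nrm p (\<lambda>x. indicator A x * f x) powr p)"
    unfolding nrm_powr[OF p] by (rule nn_integral_eq_integral) (use Lp_mem_restrict(1)[OF p f A] in \<open>auto simp: Lp_mem_def\<close>)
  finally show *: "emeasure (mass p f) A = ennreal (nrm p (\<lambda>x. indicator A x * f x) powr p)" .
  show "measure (mass p f) A = nrm p (\<lambda>x. indicator A x * f x) powr p"
    by (simp add: measure_def *)
qed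

lemma finite_measure_mass:
  assumes p: "0 < p" and f: "Lp_mem p f"
  shows "finite_measure (mass p f)"
  by (rule finite_measureI) (simp add: emeasure_mass[OF p f])

lemma measure_mass_UNIV:
  assumes p: "0 < p" and f: "Lp_mem p f"
  shows "measure (mass p f) UNIV = nrm p f powr p"
  by (simp add: measure_mass[OF p f])

lemma nrm_restrict:
  assumes p: "0 < p" and f: "Lp_mem p f" and A: "A \<in> sets borel"
  shows "nrm p (\<lambda>x. indicator A x * f x) = measure (mass p f) A powr (1 / p)"
  using p by (simp add: measure_mass[OF p f A] powr_powr)

lemma nrm_conv_perturb:
  assumes pqs: "1 < p" "1 < q" "1 < s" "1 / p + 1 / q = 1 + 1 / s"
    and k: "Lp_mem q k" and k': "Lp_mem q k'" and f: "Lp_mem p f"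
  shows "nrm s (\<lambda>x. conv k f x - conv k' f x) \<le> nrm q (\<lambda>x. k x - k' x) * nrm p f"
    and "nrm s (conv k f) \<le> nrm s (conv k' f) + nrm q (\<lambda>x. k x - k' x) * nrm p f"
proof -
  have q0: "0 < q" using pqs by simp
  note [measurable] = Lp_mem_measurable[OF k] Lp_mem_measurable[OF k'] Lp_mem_measurable[OF f]
  have "nrm s (\<lambda>x. conv k f x - conv k' f x) = nrm s (conv (\<lambda>x. k x - k' x) f)"
    by (rule nrm_cong_AE) (use conv_diff_left[OF pqs k k' f] in auto)
  also have "\<dots> \<le> nrm q (\<lambda>x. k x - k' x) * nrm p f"
    by (rule Young(3)[OF pqs Lp_mem_diff[OF q0 k k'] f])
  finally show *: "nrm s (\<lambda>x. conv k f x - conv k' f x) \<le> nrm q (\<lambda>x. k x - k' x) * nrm p f" .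
  show "nrm s (conv k f) \<le> nrm s (conv k' f) + nrm q (\<lambda>x. k x - k' x) * nrm p f"
    using nrm_triangle_diff[OF _ Young(2)[OF pqs k f] Young(2)[OF pqs k' f]] pqs(3) * by linarith
qed

text \<open>Pigeonhole: \<open>J\<close> disjoint strips share a total mass of at most 1.\<close>

lemma light_strip:
  fixes \<mu> :: "'a::euclidean_space measure"
  assumes fin: "finite_measure \<mu>" and sets [measurable_cong, simp]: "sets \<mu> = sets borel" and total: "measure \<mu> (space \<mu>) \<le> 1"
    and L: "0 < L" and J: "0 < J"
  obtains j :: nat where "j < J" "measure \<mu> {x. c + real j * L \<le> x \<bullet> b \<and> x \<bullet> b < c + real (Suc j) * L} \<le> 1 / real J"
proof -
  interpret finite_measure \<mu> by (rule fin)
  define T where "T j = {x. c + real j * L \<le> x \<bullet> b \<and> x \<bullet> b < c + real (Suc j) * L}" for j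
  have [measurable]: "T j \<in> sets borel" for j unfolding T_def by measurable
  have disj: "T i \<inter> T j = {}" if "i < j" for i j
  proof -
    from that have "real (Suc i) \<le> real j" by simp
    then have "real (Suc i) * L \<le> real j * L" using L by (intro mult_right_mono) auto
    then show ?thesis by (auto simp: T_def)
  qed
  have "disjoint_family T"
    unfolding disjoint_family_on_def
  proof (intro ballI impI)
    fix i j :: nat assume "i \<noteq> j"
    then show "T i \<inter> T j = {}" using disj[of i j] disj[of j i] by (cases "i < j") auto
  qed
  then have "(\<Sum>j<J. measure \<mu> (T j)) = measure \<mu> (\<Union>j<J. T j)"
    by (intro finite_measure_finite_Union[symmetric]) (auto simp: disjoint_family_on_def)
  also have "\<dots> \<le> 1"
    using order_trans[OF bounded_measure total] .
  finally have sum: "(\<Sum>j<J. measure \<mu> (T j)) \<le> 1" .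
  have "\<exists>j<J. measure \<mu> (T j) \<le> 1 / real J"
  proof (rule ccontr)
    assume "\<not> ?thesis"
    then have "(\<Sum>j<J. 1 / real J) < (\<Sum>j<J. measure \<mu> (T j))"
      using J by (intro sum_strict_mono) (auto simp: not_le)
    then show False using sum J by simp
  qed
  then show thesis using that by (auto simp: T_def)
qed

text \<open>If mass above \<open>e\<close> lay beyond \<open>R\<close>, the lightest strip between 2
  and \<open>R\<close> would cut \<open>f\<close> into a part of mass at least \<open>1 / 2\<close>,
  a part of mass above \<open>e\<close> and a negligible rest, too wasteful for an almost maximizing
  function. \<open>R\<close> and \<open>\<delta>\<close> are fixed before \<open>f\<close> and
  \<open>b\<close>, which gives uniformity along the sequence and over all directions.\<close>

lemma tight_direction:
  fixes k :: "'a::euclidean_space \<Rightarrow> complex"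
  assumes pqs: "1 < p" "1 < q" "1 < s" "1 / p + 1 / q = 1 + 1 / s"
    and k: "Lp_mem q k" and M: "0 < M" and bound: "\<And>f. Lp_mem p f \<Longrightarrow> nrm s (conv k f) \<le> M * nrm p f"
    and e: "0 < e" "e \<le> 1 / 2"
  obtains R \<delta> where "0 < \<delta>" "\<And>f b. Lp_mem p f \<Longrightarrow> nrm p f = 1 \<Longrightarrow> norm b = 1 \<Longrightarrow> M - \<delta> \<le> nrm s (conv k f)
      \<Longrightarrow> 1 / 2 \<le> measure (mass p f) {x. x \<bullet> b < 2} \<Longrightarrow> measure (mass p f) {x. R < x \<bullet> b} \<le> e"
proof -
  have p0: "0 < p" and q0: "0 < q" and s0: "0 < s" and s1: "1 \<le> s" using pqs by auto
  have "p < s"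
  proof -
    have "1 / q < 1" using pqs by simp
    then have "1 / s < 1 / p" using pqs(4) by linarith
    then show ?thesis using p0 s0 by (simp add: field_simps)
  qed
  define t where "t = s / p"
  have t: "1 < t" using \<open>p < s\<close> p0 by (simp add: t_def)
  \<comment> \<open>\<open>\<theta>\<close> bounds the sum of the powers \<open>t\<close> of the two
    masses, and \<open>\<eta> < 1\<close> is the resulting factor for the norm.\<close>
  define \<theta> where "\<theta> = (1 - e) powr (t - 1)"
  define \<eta> where "\<eta> = \<theta> powr (1 / s)"
  have \<theta>: "0 < \<theta>" "\<theta> < 1"
    using powr_less_mono2[of "t - 1" "1 - e" 1] e t by (auto simp: \<theta>_def)
  have \<eta>: "0 \<le> \<eta>" "\<eta> < 1"
    using powr_less_mono2[of "1 / s" \<theta> 1] \<theta> s0 by (auto simp: \<eta>_def)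
  \<comment> \<open>The errors below add up to at most \<open>4 * \<delta>\<close>, which has to
    stay below the loss \<open>M * (1 - \<eta>)\<close>; the 8 leaves a factor 2 to spare.\<close>
  define \<delta> where "\<delta> = M * (1 - \<eta>) / 8"
  have \<delta>: "0 < \<delta>" using M \<eta> by (simp add: \<delta>_def)
  obtain A B R0 where A [measurable]: "A \<in> sets borel" and R0: "0 < R0"
    and AR: "\<And>x. x \<in> A \<Longrightarrow> norm (k x) \<le> B \<and> norm x \<le> R0"
    and close: "nrm q (\<lambda>x. k x - indicator A x * k x) < \<delta>"
    using Lp_truncation[OF q0 k \<delta>] by metis
  define k' where "k' x = indicator A x * k x" for x
  have mk': "Lp_mem q k'" and nk': "nrm q k' \<le> nrm q k"
    unfolding k'_def using Lp_mem_restrict[OF q0 k A] by auto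
  have close: "nrm q (\<lambda>x. k x - k' x) \<le> \<delta>" "nrm q (\<lambda>x. k' x - k x) \<le> \<delta>"
    using close nrm_minus_commute[of q k k'] by (auto simp: k'_def)
  have supp: "k' x = 0" if "R0 < norm x" for x
    using AR[of x] that by (auto simp: k'_def indicator_def)
  \<comment> \<open>With this many strips, Young's inequality bounds the image of the lightest one
    by \<open>\<delta>\<close>. \<open>Suc J\<close> ensures that there is at least one
    strip.\<close>
  obtain J where "(nrm q k / \<delta>) powr p \<le> real J" using real_arch_simple by blast
  then have J: "(nrm q k / \<delta>) powr p \<le> real (Suc J)" by simp
  have Jsmall: "nrm q k * (1 / real (Suc J)) powr (1 / p) \<le> \<delta>"
  proof -
    have "((nrm q k / \<delta>) powr p) powr (1 / p) \<le> real (Suc J) powr (1 / p)"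
      using J p0 by (intro powr_mono2) auto
    then have "nrm q k / \<delta> \<le> real (Suc J) powr (1 / p)" using p0 \<delta> by (simp add: powr_powr)
    then have "nrm q k \<le> \<delta> * real (Suc J) powr (1 / p)"
      using \<delta> by (simp add: pos_divide_le_eq mult.commute)
    moreover have "0 < real (Suc J) powr (1 / p)" by simp
    ultimately show ?thesis by (simp add: powr_divide divide_le_eq del: of_nat_Suc)
  qed
  have k'bound: "nrm s (conv k' f) \<le> (M + \<delta>) * nrm p f" if f: "Lp_mem p f" for f
  proof -
    have "nrm q (\<lambda>x. k' x - k x) * nrm p f \<le> \<delta> * nrm p f" using close by (intro mult_right_mono) auto
    then show ?thesis
      using nrm_conv_perturb(2)[OF pqs mk' k f] bound[OF f] by (simp add: distrib_right)
  qed
  \<comment> \<open>Twice the radius of the truncated kernel: each of the two parts is spread by at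
    most \<open>R0\<close>, so the images stay on opposite sides of the hyperplane in the middle of
    the strip.\<close>
  define L where "L = 2 * R0"
  have L: "0 < L" using R0 by (simp add: L_def)
  define R where "R = 2 + real (Suc J) * L"
  show thesis
  proof (rule that[OF \<delta>, of R], rule ccontr)
    fix f :: "'a \<Rightarrow> complex" and b
    assume f: "Lp_mem p f" and f1: "nrm p f = 1" and b: "norm b = 1"
      and large: "M - \<delta> \<le> nrm s (conv k f)" and half: "1 / 2 \<le> measure (mass p f) {x. x \<bullet> b < 2}"
      and "\<not> measure (mass p f) {x. R < x \<bullet> b} \<le> e"
    then have heavy: "e < measure (mass p f) {x. R < x \<bullet> b}" by simp
    let ?\<mu> = "mass p f"
    interpret finite_measure ?\<mu> by (rule finite_measure_mass[OF p0 f])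
    have total: "measure ?\<mu> UNIV = 1" by (simp add: measure_mass_UNIV[OF p0 f] f1)
    obtain j where jJ: "j < Suc J" and strip: "measure ?\<mu> {x. 2 + real j * L \<le> x \<bullet> b \<and> x \<bullet> b < 2 + real (Suc j) * L} \<le> 1 / real (Suc J)"
      by (rule light_strip[of ?\<mu> L "Suc J" 2 b]) (use finite_measure_axioms total L in auto)
    define a where "a = 2 + real j * L"
    have a2: "2 \<le> a" using L by (simp add: a_def)
    have aL: "a + L = 2 + real (Suc j) * L" by (simp add: a_def algebra_simps)
    define A1 A2 A3 where "A1 = {x. x \<bullet> b < a}" and "A2 = {x. a + L \<le> x \<bullet> b}" and "A3 = {x. a \<le> x \<bullet> b \<and> x \<bullet> b < a + L}"
    have [measurable]: "A1 \<in> sets borel" "A2 \<in> sets borel" "A3 \<in> sets borel"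
      unfolding A1_def A2_def A3_def by measurable
    define f1 f2 f3 where "f1 x = indicator A1 x * f x" and "f2 x = indicator A2 x * f x" and "f3 x = indicator A3 x * f x" for x
    have mf: "Lp_mem p f1" "Lp_mem p f2" "Lp_mem p f3"
      unfolding f1_def f2_def f3_def using Lp_mem_restrict(1)[OF p0 f] by auto
    define \<alpha> \<beta> where "\<alpha> = measure ?\<mu> A1" and "\<beta> = measure ?\<mu> A2"
    have nf: "nrm p f1 = \<alpha> powr (1 / p)" "nrm p f2 = \<beta> powr (1 / p)" "nrm p f3 = measure ?\<mu> A3 powr (1 / p)"
      unfolding f1_def f2_def f3_def \<alpha>_def \<beta>_def by (rule nrm_restrict[OF p0 f]; measurable)+
    have \<alpha>: "1 / 2 \<le> \<alpha>"
      unfolding \<alpha>_def A1_def by (rule order_trans[OF half finite_measure_mono]) (use a2 in auto)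
    have \<beta>: "e < \<beta>"
    proof (rule less_le_trans[OF heavy], unfold \<beta>_def A2_def, rule finite_measure_mono)
      have "real (Suc j) * L \<le> real (Suc J) * L" using jJ L by (intro mult_right_mono) auto
      then show "{x. R < x \<bullet> b} \<subseteq> {x. a + L \<le> x \<bullet> b}" unfolding aL R_def by auto
    qed auto
    have "\<alpha> + \<beta> = measure ?\<mu> (A1 \<union> A2)"
      unfolding \<alpha>_def \<beta>_def using L by (intro finite_measure_Union[symmetric]) (auto simp: A1_def A2_def)
    also have "\<dots> \<le> measure ?\<mu> UNIV" by (rule finite_measure_mono) auto
    finally have sum1: "\<alpha> + \<beta> \<le> 1" using total by simp
    have pw: "c powr t \<le> c * \<theta>" if "0 < c" "c \<le> 1 - e" for c
    proof -
      have "c powr t = c * c powr (t - 1)" using that powr_add[of c 1 "t - 1"] by simp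
      also have "\<dots> \<le> c * \<theta>" unfolding \<theta>_def using that t by (intro mult_left_mono powr_mono2) auto
      finally show ?thesis .
    qed
    \<comment> \<open>Both masses are at most \<open>1 - e\<close>: the first because the second
      exceeds \<open>e\<close>, the second because the first is at least \<open>1 / 2\<close> and
      \<open>e \<le> 1 / 2\<close>.\<close>
    have "\<alpha> powr t + \<beta> powr t \<le> \<alpha> * \<theta> + \<beta> * \<theta>"
      using \<alpha> \<beta> sum1 e by (intro add_mono pw) auto
    also have "\<dots> \<le> \<theta>" using sum1 \<theta> by (simp add: mult_left_le_one_le flip: distrib_right)
    finally have ab: "\<alpha> powr t + \<beta> powr t \<le> \<theta>" .
    let ?g1 = "conv k' f1" and ?g2 = "conv k' f2"
    have mg: "Lp_mem s ?g1" "Lp_mem s ?g2" by (auto intro: Young(2)[OF pqs mk' mf(1)] Young(2)[OF pqs mk' mf(2)])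
    have b_le: "\<bar>z \<bullet> b\<bar> \<le> norm z" for z
      using Cauchy_Schwarz_ineq2[of z b] b by simp
    have disj: "?g1 x = 0 \<or> ?g2 x = 0" for x
    \<comment> \<open>The middle hyperplane: below it \<open>x\<close> is too far from
      \<open>A2\<close> for the kernel, on or above it too far from \<open>A1\<close>, the strict
      bound in \<open>A1\<close> covering the hyperplane itself.\<close>
    proof (cases "x \<bullet> b < a + R0")
      case True
      have "k' (x - y) * f2 y = 0" for y
      proof (cases "y \<in> A2")
        case yA: True
        have "R0 < (y - x) \<bullet> b" using yA True by (auto simp: A2_def L_def inner_diff_left)
        then have "R0 < norm (x - y)" using b_le[of "y - x"] by (simp add: norm_minus_commute)
        then show ?thesis using supp by simp
      qed (simp add: f2_def)
      then have "(\<lambda>y. k' (x - y) * f2 y) = (\<lambda>_. 0)" by blast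
      then have "?g2 x = 0" by (simp add: conv_def)
      then show ?thesis ..
    next
      case False
      have "k' (x - y) * f1 y = 0" for y
      proof (cases "y \<in> A1")
        case yA: True
        have "R0 < (x - y) \<bullet> b" using yA False by (auto simp: A1_def inner_diff_left)
        then have "R0 < norm (x - y)" using b_le[of "x - y"] by simp
        then show ?thesis using supp by simp
      qed (simp add: f1_def)
      then have "(\<lambda>y. k' (x - y) * f1 y) = (\<lambda>_. 0)" by blast
      then have "?g1 x = 0" by (simp add: conv_def)
      then show ?thesis ..
    qed
    have "nrm s (\<lambda>x. ?g1 x + ?g2 x) powr s = (LINT x|lborel. norm (?g1 x) powr s + norm (?g2 x) powr s)"
      unfolding nrm_powr[OF s0]
    proof (rule Bochner_Integration.integral_cong[OF refl])
      show "norm (?g1 x + ?g2 x) powr s = norm (?g1 x) powr s + norm (?g2 x) powr s" for x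
        using disj[of x] by auto
    qed
    also have "\<dots> = nrm s ?g1 powr s + nrm s ?g2 powr s"
      using mg s0 by (simp add: nrm_powr Lp_mem_def)
    also have "\<dots> \<le> ((M + \<delta>) * \<alpha> powr (1 / p)) powr s + ((M + \<delta>) * \<beta> powr (1 / p)) powr s"
      using k'bound[OF mf(1)] k'bound[OF mf(2)] s0 unfolding nf by (intro add_mono powr_mono2) auto
    also have "\<dots> = (M + \<delta>) powr s * (\<alpha> powr t + \<beta> powr t)"
      using M \<delta> by (simp add: powr_mult powr_powr t_def distrib_left)
    also have "\<dots> \<le> (M + \<delta>) powr s * \<theta>" using ab by (intro mult_left_mono) auto
    also have "\<dots> = ((M + \<delta>) * \<eta>) powr s"
      using M \<delta> \<theta> s0 by (simp add: \<eta>_def powr_mult powr_powr)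
    finally have "nrm s (\<lambda>x. ?g1 x + ?g2 x) powr s \<le> ((M + \<delta>) * \<eta>) powr s" .
    then have n12: "nrm s (\<lambda>x. ?g1 x + ?g2 x) \<le> (M + \<delta>) * \<eta>"
      using M \<delta> \<eta> s0 by (subst nrm_le_iff) (auto simp: nrm_powr)
    have n3: "nrm s (conv k' f3) \<le> \<delta>"
    proof -
      have "measure ?\<mu> A3 \<le> 1 / real (Suc J)" using strip unfolding A3_def aL unfolding a_def .
      then have "measure ?\<mu> A3 powr (1 / p) \<le> (1 / real (Suc J)) powr (1 / p)"
        using p0 by (intro powr_mono2) auto
      then have "nrm q k' * nrm p f3 \<le> nrm q k * (1 / real (Suc J)) powr (1 / p)"
        unfolding nf using nk' by (intro mult_mono) auto
      then show ?thesis using Young(3)[OF pqs mk' mf(3)] Jsmall by linarith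
    qed
    have "f = (\<lambda>x. (f1 x + f2 x) + f3 x)"
    proof
      fix x
      show "f x = (f1 x + f2 x) + f3 x"
        using L by (auto simp: f1_def f2_def f3_def A1_def A2_def A3_def indicator_def)
    qed
    then have "conv k' f = conv k' (\<lambda>x. (f1 x + f2 x) + f3 x)" by simp
    moreover have "AE x in lborel. conv k' (\<lambda>x. (f1 x + f2 x) + f3 x) x = (?g1 x + ?g2 x) + conv k' f3 x"
      using conv_add_right[OF pqs mk' mf(1,2)] conv_add_right[OF pqs mk' Lp_mem_add[OF p0 mf(1,2)] mf(3)]
      by eventually_elim simp
    ultimately have "AE x in lborel. conv k' f x = (?g1 x + ?g2 x) + conv k' f3 x" by simp
    note [measurable] = Lp_mem_measurable[OF mk'] Lp_mem_measurable[OF f] Lp_mem_measurable[OF mf(1)] Lp_mem_measurable[OF mf(2)] Lp_mem_measurable[OF mf(3)]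
    have "nrm s (conv k' f) = nrm s (\<lambda>x. (?g1 x + ?g2 x) + conv k' f3 x)"
      by (rule nrm_cong_AE) (measurable, fact)
    also have "\<dots> \<le> nrm s (\<lambda>x. ?g1 x + ?g2 x) + nrm s (conv k' f3)"
      by (rule nrm_triangle[OF s1 Lp_mem_add[OF s0 mg] Young(2)[OF pqs mk' mf(3)]])
    finally have "nrm s (conv k' f) \<le> (M + \<delta>) * \<eta> + \<delta>" using n12 n3 by linarith
    then have "nrm s (conv k f) \<le> (M + \<delta>) * \<eta> + 2 * \<delta>"
      using nrm_conv_perturb(2)[OF pqs k mk' f] close(1) \<open>nrm p f = 1\<close> by simp
    \<comment> \<open>Three \<open>\<delta>\<close> come from the near maximality, the strip and the
      change of kernel; \<open>\<delta> * \<eta>\<close> comes from the bound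
      \<open>M + \<delta>\<close> for the truncated kernel.\<close>
    then have "M \<le> M * \<eta> + \<delta> * \<eta> + 3 * \<delta>" using large by (simp add: distrib_right)
    moreover have "\<delta> * \<eta> \<le> \<delta>" using \<delta> \<eta> by (simp add: mult_left_le)
    ultimately have "M * (1 - \<eta>) \<le> 4 * \<delta>" by (simp add: algebra_simps)
    moreover have "0 < M * (1 - \<eta>)" using M \<eta> by simp
    ultimately show False by (simp add: \<delta>_def)
  qed
qed

text \<open>The directional estimate is used for the coordinate directions and their negatives, so
  the allowed mass \<open>e powr p\<close> is divided by twice the dimension. The minimum with
  \<open>1 / 2\<close> meets the condition on \<open>e\<close> there.\<close>

lemma tight_ball:
  fixes k :: "'a::euclidean_space \<Rightarrow> complex"
  assumes pqs: "1 < p" "1 < q" "1 < s" "1 / p + 1 / q = 1 + 1 / s"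
    and k: "Lp_mem q k" and M: "0 < M" and bound: "\<And>f. Lp_mem p f \<Longrightarrow> nrm s (conv k f) \<le> M * nrm p f"
    and e: "0 < e"
  obtains R \<delta> where "0 < \<delta>" "\<And>f. Lp_mem p f \<Longrightarrow> nrm p f = 1 \<Longrightarrow> M - \<delta> \<le> nrm s (conv k f)
      \<Longrightarrow> (\<And>b. b \<in> Basis \<Longrightarrow> 1 / 2 \<le> measure (mass p f) {x. x \<bullet> b < 2} \<and> 1 / 2 \<le> measure (mass p f) {x. x \<bullet> (- b) < 2})
      \<Longrightarrow> nrm p (\<lambda>x. indicator {x. R < norm x} x * f x) \<le> e"
proof -
  have p0: "0 < p" using pqs by simp
  define d where "d = min (1 / 2) (e powr p / (2 * DIM('a)))"
  have d: "0 < d" "d \<le> 1 / 2" using e by (auto simp: d_def)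
  have d2: "d * (2 * DIM('a)) \<le> e powr p"
  proof -
    have "d \<le> e powr p / (2 * DIM('a))" by (simp add: d_def)
    then show ?thesis by (simp add: pos_le_divide_eq)
  qed
  obtain R \<delta> where \<delta>: "0 < \<delta>" and R: "\<And>f b. Lp_mem p f \<Longrightarrow> nrm p f = 1 \<Longrightarrow> norm b = 1 \<Longrightarrow> M - \<delta> \<le> nrm s (conv k f)
      \<Longrightarrow> 1 / 2 \<le> measure (mass p f) {x. x \<bullet> b < 2} \<Longrightarrow> measure (mass p f) {x. R < x \<bullet> b} \<le> d"
    using tight_direction[OF pqs k M bound d] by metis
  show thesis
  proof (rule that[OF \<delta>, of "real DIM('a) * R"])
    fix f :: "'a \<Rightarrow> complex" assume f: "Lp_mem p f" and f1: "nrm p f = 1" and large: "M - \<delta> \<le> nrm s (conv k f)"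
      and med: "\<And>b. b \<in> Basis \<Longrightarrow> 1 / 2 \<le> measure (mass p f) {x. x \<bullet> b < 2} \<and> 1 / 2 \<le> measure (mass p f) {x. x \<bullet> (- b) < 2}"
    let ?\<mu> = "mass p f"
    interpret finite_measure ?\<mu> by (rule finite_measure_mass[OF p0 f])
    define H where "H b = {x::'a. R < x \<bullet> b} \<union> {x. R < x \<bullet> (- b)}" for b
    have [measurable]: "H b \<in> sets borel" for b unfolding H_def by measurable
    \<comment> \<open>The norm is at most the sum of the moduli of the coordinates, so outside
      radius \<open>DIM('a) * R\<close> some coordinate exceeds \<open>R\<close> in modulus.\<close>
    have sub: "{x. real DIM('a) * R < norm x} \<subseteq> (\<Union>b\<in>Basis. H b)"
    proof (rule subsetI, rule ccontr)
      fix x :: 'a assume x: "x \<in> {x. real DIM('a) * R < norm x}" and "x \<notin> (\<Union>b\<in>Basis. H b)"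
      then have "\<bar>x \<bullet> b\<bar> \<le> R" if "b \<in> Basis" for b using that by (force simp: H_def abs_le_iff)
      then have "(\<Sum>b\<in>Basis. \<bar>x \<bullet> b\<bar>) \<le> real DIM('a) * R" by (rule sum_bounded_above)
      then show False using norm_le_l1[of x] x by simp
    qed
    have "measure ?\<mu> {x. real DIM('a) * R < norm x} \<le> measure ?\<mu> (\<Union>b\<in>Basis. H b)"
      by (rule finite_measure_mono[OF sub]) (simp only: sets_mass, rule sets.finite_UN, auto)
    also have "\<dots> \<le> (\<Sum>b\<in>Basis. measure ?\<mu> (H b))"
      by (rule finite_measure_subadditive_finite) auto
    also have "\<dots> \<le> (\<Sum>b\<in>(Basis::'a set). 2 * d)"
    proof (rule sum_mono)
      fix b :: 'a assume b: "b \<in> Basis"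
      have "measure ?\<mu> (H b) \<le> measure ?\<mu> {x. R < x \<bullet> b} + measure ?\<mu> {x. R < x \<bullet> (- b)}"
        unfolding H_def by (rule measure_Un_le) auto
      also have "\<dots> \<le> d + d"
        using R[OF f f1 _ large, of b] R[OF f f1 _ large, of "- b"] med[OF b] b by (intro add_mono) auto
      finally show "measure ?\<mu> (H b) \<le> 2 * d" by simp
    qed
    also have "\<dots> \<le> e powr p" using d2 by (simp add: mult.commute mult.left_commute)
    finally have "measure ?\<mu> {x. real DIM('a) * R < norm x} powr (1 / p) \<le> (e powr p) powr (1 / p)"
      using p0 by (intro powr_mono2) auto
    then show "nrm p (\<lambda>x. indicator {x. real DIM('a) * R < norm x} x * f x) \<le> e"
      using p0 e by (subst nrm_restrict[OF p0 f]) (auto simp: powr_powr)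
  qed
qed

text \<open>Medians at integer points up to an error of 1 are enough, and atoms of the law of \<open>x \<bullet> b\<close> do not matter.\<close>

lemma integer_median:
  fixes \<mu> :: "'a::euclidean_space measure"
  assumes fin: "finite_measure \<mu>" and sets [measurable_cong, simp]: "sets \<mu> = sets borel" and total: "measure \<mu> UNIV = 1"
  obtains m :: real where "1 / 2 \<le> measure \<mu> {x. x \<bullet> b < m}" "1 / 2 \<le> measure \<mu> {x. m - 1 \<le> x \<bullet> b}"
proof -
  interpret finite_measure \<mu> by (rule fin)
  have space [simp]: "space \<mu> = UNIV" using sets_eq_imp_space_eq[OF sets] by simp
  have "(\<lambda>n. measure \<mu> {x. x \<bullet> b < real n}) \<longlonglongrightarrow> measure \<mu> (\<Union>n. {x. x \<bullet> b < real n})"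
    by (rule finite_Lim_measure_incseq) (auto simp: incseq_def intro: less_le_trans)
  also have "(\<Union>n. {x. x \<bullet> b < real n}) = UNIV" using reals_Archimedean2 by auto
  finally have "(\<lambda>n. measure \<mu> {x. x \<bullet> b < real n}) \<longlonglongrightarrow> 1" using total by simp
  then have up: "eventually (\<lambda>n. 1 / 2 < measure \<mu> {x. x \<bullet> b < real n}) sequentially"
    by (rule order_tendstoD) simp
  have "(\<lambda>n. measure \<mu> {x. x \<bullet> b < - real n}) \<longlonglongrightarrow> measure \<mu> (\<Inter>n. {x. x \<bullet> b < - real n})"
    by (rule finite_Lim_measure_decseq) (auto simp: decseq_def intro: less_le_trans)
  also have "(\<Inter>n. {x. x \<bullet> b < - real n}) = {}"
  proof -
    have "\<exists>n. \<not> x \<bullet> b < - real n" for x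
    proof -
      obtain n where "- (x \<bullet> b) < real n" using reals_Archimedean2 by blast
      then show ?thesis by (intro exI[of _ n]) linarith
    qed
    then show ?thesis by blast
  qed
  finally have "(\<lambda>n. measure \<mu> {x. x \<bullet> b < - real n}) \<longlonglongrightarrow> 0" by simp
  then have "eventually (\<lambda>n. measure \<mu> {x. x \<bullet> b < - real n} < 1 / 2) sequentially"
    by (rule order_tendstoD) simp
  from eventually_conj[OF up this] obtain N where N: "1 / 2 < measure \<mu> {x. x \<bullet> b < real N}" "measure \<mu> {x. x \<bullet> b < - real N} < 1 / 2"
    by (auto dest: eventually_happens)
  \<comment> \<open>The offset \<open>N\<close> turns the search over integers into a least natural
    number. It is positive because \<open>P 0\<close> fails, so it has a predecessor at which
    \<open>P\<close> fails; this yields the bound at \<open>m - 1\<close>.\<close>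
  define P where "P n \<longleftrightarrow> 1 / 2 \<le> measure \<mu> {x. x \<bullet> b < real n - real N}" for n
  have "P (2 * N)" using N by (simp add: P_def)
  define n where "n = (LEAST n. P n)"
  have Pn: "P n" unfolding n_def by (rule LeastI[of P, OF \<open>P (2 * N)\<close>])
  have "\<not> P 0" using N by (simp add: P_def)
  then obtain l where l: "n = Suc l" using Pn by (cases n) auto
  then have "\<not> P l" using not_less_Least[of l P] by (simp add: n_def)
  then have lt: "measure \<mu> {x. x \<bullet> b < real n - real N - 1} < 1 / 2" by (simp add: P_def l)
  have "{x. real n - real N - 1 \<le> x \<bullet> b} = space \<mu> - {x. x \<bullet> b < real n - real N - 1}" by auto
  then have "measure \<mu> {x. real n - real N - 1 \<le> x \<bullet> b} = 1 - measure \<mu> {x. x \<bullet> b < real n - real N - 1}"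
    using finite_measure_compl[of "{x. x \<bullet> b < real n - real N - 1}"] total by simp
  then show thesis using that[of "real n - real N"] Pn lt by (simp add: P_def)
qed

text \<open>Moving the coordinatewise medians \<open>m b\<close> to 0 leaves half of the mass where
  \<open>x \<bullet> b < 0\<close> and half where \<open>x \<bullet> b \<ge> -1\<close>. The
  threshold 2 contains both cases, so one condition serves \<open>b\<close> and \<open>- b\<close>
  alike.\<close>

lemma centred_translate:
  fixes f :: "'a::euclidean_space \<Rightarrow> complex"
  assumes p: "0 < p" and f: "Lp_mem p f" and f1: "nrm p f = 1"
  obtains a where "\<And>b. b \<in> Basis \<Longrightarrow> 1 / 2 \<le> measure (mass p (\<lambda>x. f (x + a))) {x. x \<bullet> b < 2}
      \<and> 1 / 2 \<le> measure (mass p (\<lambda>x. f (x + a))) {x. x \<bullet> (- b) < 2}"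
proof -
  interpret finite_measure "mass p f" by (rule finite_measure_mass[OF p f])
  have "\<exists>m. 1 / 2 \<le> measure (mass p f) {x. x \<bullet> b < m} \<and> 1 / 2 \<le> measure (mass p f) {x. m - 1 \<le> x \<bullet> b}" for b
    by (rule integer_median[of "mass p f" b]) (use finite_measure_axioms measure_mass_UNIV[OF p f] f1 in auto)
  then obtain m where m: "\<And>b. 1 / 2 \<le> measure (mass p f) {x. x \<bullet> b < m b}" "\<And>b. 1 / 2 \<le> measure (mass p f) {x. m b - 1 \<le> x \<bullet> b}"
    by metis
  define a where "a = (\<Sum>b\<in>Basis. m b *\<^sub>R b)"
  have ab: "a \<bullet> b = m b" if "b \<in> Basis" for b using that by (simp add: a_def)
  have shift: "measure (mass p (\<lambda>x. f (x + a))) {x. x + a \<in> A} = measure (mass p f) A" if A: "A \<in> sets borel" for A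
  proof -
    have "{x. x + a \<in> A} \<in> sets borel"
      using measurable_sets[of "\<lambda>x. x + a" borel borel A] A by (simp add: vimage_def)
    then have "measure (mass p (\<lambda>x. f (x + a))) {x. x + a \<in> A}
        = nrm p (\<lambda>x. indicator A (x + a) * f (x + a)) powr p"
      by (subst measure_mass[OF p Lp_shift(1)[OF f]]) (auto simp: indicator_def)
    also have "\<dots> = nrm p (\<lambda>x. indicator A x * f x) powr p"
      using Lp_shift(2)[OF Lp_mem_restrict(1)[OF p f A], of a] by simp
    finally show ?thesis by (simp add: measure_mass[OF p f A])
  qed
  interpret a: finite_measure "mass p (\<lambda>x. f (x + a))" by (rule finite_measure_mass[OF p Lp_shift(1)[OF f]])
  show thesis
  proof (rule that[of a], rule conjI)
    fix b :: 'a assume b: "b \<in> Basis"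
    have "1 / 2 \<le> measure (mass p (\<lambda>x. f (x + a))) {x. x + a \<in> {x. x \<bullet> b < m b}}"
      using m(1)[of b] by (subst shift) auto
    also have "\<dots> \<le> measure (mass p (\<lambda>x. f (x + a))) {x. x \<bullet> b < 2}"
      by (rule a.finite_measure_mono) (auto simp: inner_add_left ab[OF b])
    finally show "1 / 2 \<le> measure (mass p (\<lambda>x. f (x + a))) {x. x \<bullet> b < 2}" .
    have "1 / 2 \<le> measure (mass p (\<lambda>x. f (x + a))) {x. x + a \<in> {x. m b - 1 \<le> x \<bullet> b}}"
      using m(2)[of b] by (subst shift) auto
    also have "\<dots> \<le> measure (mass p (\<lambda>x. f (x + a))) {x. x \<bullet> (- b) < 2}"
      by (rule a.finite_measure_mono) (auto simp: inner_add_left ab[OF b])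
    finally show "1 / 2 \<le> measure (mass p (\<lambda>x. f (x + a))) {x. x \<bullet> (- b) < 2}" .
  qed
qed

section \<open>Existence of a maximizer\<close>

lemma Lp_unit_exists:
  assumes p: "0 < p"
  obtains f :: "'a::euclidean_space \<Rightarrow> complex" where "Lp_mem p f" "nrm p f = 1"
proof -
  let ?g = "\<lambda>x::'a. 1 * indicator (cball 0 1) x :: complex"
  have g: "Lp_mem p ?g" by (rule Lp_mem_indicator_cball[OF p])
  have "norm (?g x) powr p = indicator (cball 0 1) x" for x by (auto simp: indicator_def)
  then have "nrm p ?g = (measure lborel (cball (0::'a) 1)) powr (1 / p)"
    by (simp add: nrm_def)
  moreover have "0 < measure lborel (cball (0::'a) 1)"
    using content_cball_pos[of 1 "0::'a"] by simp
  ultimately have pos: "0 < nrm p ?g" by simp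
  show thesis
  proof
    show "Lp_mem p (\<lambda>x. of_real (1 / nrm p ?g) * ?g x)" by (rule Lp_mem_cmult[OF p g])
    show "nrm p (\<lambda>x. of_real (1 / nrm p ?g) * ?g x) = 1"
      unfolding nrm_cmult[OF p] norm_of_real using pos by simp
  qed
qed

lemma conv_perturb_both:
  assumes pqs: "1 < p" "1 < q" "1 < s" "1 / p + 1 / q = 1 + 1 / s"
    and k: "Lp_mem q k" and k': "Lp_mem q k'" and f: "Lp_mem p f" and f': "Lp_mem p f'"
  shows "nrm s (\<lambda>x. conv k f x - conv k' f' x) \<le> nrm q (\<lambda>x. k x - k' x) * nrm p f + nrm q k' * nrm p (\<lambda>x. f x - f' x)"
proof -
  have p0: "0 < p" and s0: "0 < s" and s1: "1 \<le> s" using pqs by auto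
  have d: "Lp_mem p (\<lambda>x. f x - f' x)" by (rule Lp_mem_diff[OF p0 f f'])
  note [measurable] = Lp_mem_measurable[OF k] Lp_mem_measurable[OF k'] Lp_mem_measurable[OF f] Lp_mem_measurable[OF f']
  have mA: "Lp_mem s (\<lambda>x. conv k f x - conv k' f x)"
    by (rule Lp_mem_diff[OF s0 Young(2)[OF pqs k f] Young(2)[OF pqs k' f]])
  have mB: "Lp_mem s (conv k' (\<lambda>x. f x - f' x))" by (rule Young(2)[OF pqs k' d])
  have ae: "AE x in lborel. conv k f x - conv k' f' x = (conv k f x - conv k' f x) + conv k' (\<lambda>x. f x - f' x) x"
    using conv_add_right[OF pqs k' f' d] by eventually_elim simp
  have "nrm s (\<lambda>x. conv k f x - conv k' f' x) = nrm s (\<lambda>x. (conv k f x - conv k' f x) + conv k' (\<lambda>x. f x - f' x) x)"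
    by (rule nrm_cong_AE) (measurable, fact ae)
  also have "\<dots> \<le> nrm s (\<lambda>x. conv k f x - conv k' f x) + nrm s (conv k' (\<lambda>x. f x - f' x))"
    by (rule nrm_triangle[OF s1 mA mB])
  also have "\<dots> \<le> nrm q (\<lambda>x. k x - k' x) * nrm p f + nrm q k' * nrm p (\<lambda>x. f x - f' x)"
    by (intro add_mono nrm_conv_perturb(1)[OF pqs k k' f] Young(3)[OF pqs k' d])
  finally show ?thesis .
qed

text \<open>Replacing \<open>k\<close> by a continuous kernel of compact support and cutting
  \<open>f n\<close> to a ball changes the images by a small amount, uniformly for late
  \<open>n\<close>; the replaced images satisfy the Arzela-Ascoli conditions. Of \<open>f\<close>
  only normalization and tightness enter.\<close>

lemma tight_maximizing_precompact:
  fixes k :: "'a::euclidean_space \<Rightarrow> complex"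
  assumes pqs: "1 < p" "1 < q" "1 < s" "1 / p + 1 / q = 1 + 1 / s"
    and k: "Lp_mem q k" and f: "\<And>n. Lp_mem p (f n)" and f1: "\<And>n. nrm p (f n) = 1"
    and tight: "\<And>e. 0 < e \<Longrightarrow> \<exists>R N. \<forall>n\<ge>N. nrm p (\<lambda>x. indicator {x. R < norm x} x * f n x) \<le> e"
  obtains \<sigma> :: "nat \<Rightarrow> nat" and g where "strict_mono \<sigma>" "Lp_mem s g" "(\<lambda>n. nrm s (\<lambda>x. conv k (f (\<sigma> n)) x - g x)) \<longlonglongrightarrow> 0"
proof -
  have p0: "0 < p" and q0: "0 < q" and q1: "1 \<le> q" and s1: "1 \<le> s" using pqs by auto
  show thesis
  proof (rule Lp_precompact[OF s1, of "\<lambda>n. conv k (f n)"])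
    show "Lp_mem s (conv k (f n))" for n by (rule Young(2)[OF pqs k f])
    fix e :: real assume e: "0 < e"
    obtain k' R0 where k': "continuous_on UNIV k'" and supp: "\<And>x. R0 < norm x \<Longrightarrow> k' x = 0" and mk': "Lp_mem q k'"
      and close: "nrm q (\<lambda>x. k x - k' x) < e / 2"
      using Lp_Cc_dense[OF q1 k, of "e / 2"] e by (metis half_gt_zero)
    define c where "c = nrm q k'"
    have c: "0 \<le> c" by (simp add: c_def)
    \<comment> \<open>The tail is multiplied by the norm \<open>c\<close> of the new kernel;
      \<open>c + 1\<close> keeps the quotient defined when \<open>c = 0\<close>.\<close>
    obtain R N where RN: "\<And>n. n \<ge> N \<Longrightarrow> nrm p (\<lambda>x. indicator {x. R < norm x} x * f n x) \<le> e / (2 * (c + 1))"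
      using tight[of "e / (2 * (c + 1))"] e c by auto
    define F where "F n x = indicator {x. norm x \<le> R} x * f n x" for n x
    have mF: "Lp_mem p (F n)" and nF: "nrm p (F n) \<le> 1" for n
      unfolding F_def using Lp_mem_restrict[OF p0 f, of "{x. norm x \<le> R}"] f1 by auto
    have "equibounded_support (\<lambda>n. conv k' (F n))" "equicontinuous (\<lambda>n. conv k' (F n))"
      by (rule conv_Cc_compact[where R = R0 and R' = R, OF pqs(1) k'];
          use supp mF nF in \<open>auto simp: F_def\<close>)+
    moreover have "nrm s (\<lambda>x. conv k (f n) x - conv k' (F n) x) \<le> e" if n: "n \<ge> N" for n
    proof -
      have eq: "(\<lambda>x. f n x - F n x) = (\<lambda>x. indicator {x. R < norm x} x * f n x)"
        by (auto simp: F_def indicator_def)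
      have "nrm s (\<lambda>x. conv k (f n) x - conv k' (F n) x) \<le> e / 2 * 1 + c * (e / (2 * (c + 1)))"
        using conv_perturb_both[OF pqs k mk' f[of n] mF[of n]] close mult_left_mono[OF RN[OF n] c]
        unfolding eq f1 c_def[symmetric] by linarith
      also have "c * (e / (2 * (c + 1))) \<le> e / 2" using c e by (simp add: field_simps)
      finally show ?thesis by simp
    qed
    ultimately show "\<exists>u N. equibounded_support u \<and> equicontinuous u \<and> (\<forall>n\<ge>N. nrm s (\<lambda>x. conv k (f n) x - u n x) \<le> e)"
      by blast
  qed (rule that)
qed

text \<open>
  The limit of the images need not be shown to be an image: passing to the dual extremal \<open>h\<close> of the
  limit and then to the dual extremal of the adjoint convolution of \<open>h\<close> gives the maximizer.
\<close>

theorem conv_maximizer: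
  fixes k :: "'a::euclidean_space \<Rightarrow> complex"
  assumes pqs: "1 < p" "1 < q" "1 < s" "1 / p + 1 / q = 1 + 1 / s" and k: "Lp_mem q k"
  obtains f where "Lp_mem p f" "nrm p f = 1"
    "\<And>g. Lp_mem p g \<Longrightarrow> nrm p g = 1 \<Longrightarrow> nrm s (conv k g) \<le> nrm s (conv k f)"
proof -
  have p0: "0 < p" and q0: "0 < q" and s0: "0 < s" and s1: "1 \<le> s" using pqs by auto
  define S where "S = (\<lambda>f. nrm s (conv k f)) ` {f. Lp_mem p f \<and> nrm p f = 1}"
  define M where "M = Sup S"
  obtain f0 :: "'a \<Rightarrow> complex" where f0: "Lp_mem p f0" "nrm p f0 = 1" by (rule Lp_unit_exists[OF p0])
  have "S \<noteq> {}" using f0 by (auto simp: S_def)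
  have "bdd_above S"
  proof (rule bdd_aboveI[of _ "nrm q k"])
    show "x \<le> nrm q k" if "x \<in> S" for x using that Young(3)[OF pqs k] by (fastforce simp: S_def)
  qed
  then have M: "nrm s (conv k g) \<le> M" if "Lp_mem p g" "nrm p g = 1" for g
    unfolding M_def using that by (intro cSup_upper) (auto simp: S_def)
  show thesis
  \<comment> \<open>If the supremum is 0, every unit function is a maximizer; tightness needs
    \<open>M > 0\<close> for a genuine loss.\<close>
  proof (cases "M \<le> 0")
    case True
    show thesis
      by (rule that[OF f0]) (use M True nrm_nonneg[of s "conv k f0"] in \<open>blast intro: order_trans\<close>)
  next
    case False
    then have M0: "0 < M" by simp
    have bound: "nrm s (conv k g) \<le> M * nrm p g" if g: "Lp_mem p g" for g
    proof (cases "nrm p g = 0")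
      case True
      then show ?thesis using Young(3)[OF pqs k g] by simp
    next
      case False
      then have pos: "0 < nrm p g" using nrm_nonneg[of p g] by linarith
      let ?c = "complex_of_real (1 / nrm p g)"
      have nc: "norm ?c = 1 / nrm p g" unfolding norm_of_real using pos by simp
      have "nrm s (conv k (\<lambda>x. ?c * g x)) \<le> M"
        by (rule M[OF Lp_mem_cmult[OF p0 g]]) (simp only: nrm_cmult[OF p0] nc, use pos in simp)
      also have "conv k (\<lambda>x. ?c * g x) = (\<lambda>x. ?c * conv k g x)" by (rule ext) (rule conv_cmult)
      finally show ?thesis unfolding nrm_cmult[OF s0] nc using pos by (simp add: pos_divide_le_eq)
    qed
    have "\<exists>f. Lp_mem p f \<and> nrm p f = 1 \<and> M - 1 / real (Suc n) < nrm s (conv k f) \<and>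
        (\<forall>b\<in>Basis. 1 / 2 \<le> measure (mass p f) {x. x \<bullet> b < 2} \<and> 1 / 2 \<le> measure (mass p f) {x. x \<bullet> (- b) < 2})" for n
    proof -
      have "M - 1 / real (Suc n) < Sup S" by (simp add: M_def)
      then obtain g where g: "Lp_mem p g" "nrm p g = 1" "M - 1 / real (Suc n) < nrm s (conv k g)"
        using less_cSup_iff[OF \<open>S \<noteq> {}\<close> \<open>bdd_above S\<close>] by (auto simp: S_def)
      obtain a where a: "\<And>b. b \<in> Basis \<Longrightarrow> 1 / 2 \<le> measure (mass p (\<lambda>x. g (x + a))) {x. x \<bullet> b < 2}
          \<and> 1 / 2 \<le> measure (mass p (\<lambda>x. g (x + a))) {x. x \<bullet> (- b) < 2}"
        using centred_translate[OF p0 g(1,2)] by blast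
      \<comment> \<open>Translation invariance: recentring costs nothing in the value being
        maximized.\<close>
      have "conv k (\<lambda>x. g (x + a)) = (\<lambda>x. conv k g (x + a))"
        by (rule ext) (rule conv_shift[OF Lp_mem_measurable[OF k] Lp_mem_measurable[OF g(1)]])
      then have "nrm s (conv k (\<lambda>x. g (x + a))) = nrm s (conv k g)"
        using Lp_shift(2)[OF Young(2)[OF pqs k g(1)], of a] by simp
      then show ?thesis
        using Lp_shift[OF g(1), of a] g(2,3) a by (intro exI[of _ "\<lambda>x. g (x + a)"]) auto
    qed
    then obtain f where f: "\<And>n. Lp_mem p (f n)" and f1: "\<And>n. nrm p (f n) = 1"
      and large: "\<And>n. M - 1 / real (Suc n) < nrm s (conv k (f n))"
      and med: "\<And>n b. b \<in> Basis \<Longrightarrow> 1 / 2 \<le> measure (mass p (f n)) {x. x \<bullet> b < 2} \<and> 1 / 2 \<le> measure (mass p (f n)) {x. x \<bullet> (- b) < 2}"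
      by metis
    have tight: "\<exists>R N. \<forall>n\<ge>N. nrm p (\<lambda>x. indicator {x. R < norm x} x * f n x) \<le> e" if e: "0 < e" for e
    proof -
      obtain R \<delta> where \<delta>: "0 < \<delta>" and R: "\<And>f. Lp_mem p f \<Longrightarrow> nrm p f = 1 \<Longrightarrow> M - \<delta> \<le> nrm s (conv k f)
        \<Longrightarrow> (\<And>b. b \<in> Basis \<Longrightarrow> 1 / 2 \<le> measure (mass p f) {x. x \<bullet> b < 2} \<and> 1 / 2 \<le> measure (mass p f) {x. x \<bullet> (- b) < 2})
        \<Longrightarrow> nrm p (\<lambda>x. indicator {x. R < norm x} x * f x) \<le> e"
        using tight_ball[OF pqs k M0 bound e] by blast
      obtain N where N: "1 / real (Suc N) < \<delta>" using \<delta> reals_Archimedean[of \<delta>] by (auto simp: inverse_eq_divide)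
      have "nrm p (\<lambda>x. indicator {x. R < norm x} x * f n x) \<le> e" if "n \<ge> N" for n
      proof (rule R[OF f f1 _ med])
        have "1 / real (Suc n) \<le> 1 / real (Suc N)" using that by (simp add: frac_le)
        then show "M - \<delta> \<le> nrm s (conv k (f n))" using large[of n] N by linarith
      qed
      then show ?thesis by blast
    qed
    obtain \<sigma> :: "nat \<Rightarrow> nat" and g where \<sigma>: "strict_mono \<sigma>" and g: "Lp_mem s g"
      and lim: "(\<lambda>n. nrm s (\<lambda>x. conv k (f (\<sigma> n)) x - g x)) \<longlonglongrightarrow> 0"
      using tight_maximizing_precompact[OF pqs k f f1 tight] by blast
    have mv: "Lp_mem s (conv k (f n))" for n by (rule Young(2)[OF pqs k f])
    \<comment> \<open>Strong convergence of the images prevents any loss of norm in the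
      limit.\<close>
    have Mg: "M \<le> nrm s g"
    proof (rule LIMSEQ_le_const)
      have "(\<lambda>n. 1 / real (Suc n)) \<longlonglongrightarrow> 0" using LIMSEQ_inverse_real_of_nat by (simp add: inverse_eq_divide)
      then have "(\<lambda>n. 1 / real (Suc (\<sigma> n))) \<longlonglongrightarrow> 0"
        using LIMSEQ_subseq_LIMSEQ[OF _ \<sigma>] by (force simp: o_def)
      from tendsto_add[OF tendsto_add[OF tendsto_const lim] this]
      show "(\<lambda>n. nrm s g + nrm s (\<lambda>x. conv k (f (\<sigma> n)) x - g x) + 1 / real (Suc (\<sigma> n))) \<longlonglongrightarrow> nrm s g" by simp
      show "\<exists>N. \<forall>n\<ge>N. M \<le> nrm s g + nrm s (\<lambda>x. conv k (f (\<sigma> n)) x - g x) + 1 / real (Suc (\<sigma> n))"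
      proof (intro exI[of _ 0] allI impI)
        fix n
        show "M \<le> nrm s g + nrm s (\<lambda>x. conv k (f (\<sigma> n)) x - g x) + 1 / real (Suc (\<sigma> n))"
          using nrm_triangle_diff[OF s1 mv g, of "\<sigma> n"] large[of "\<sigma> n"] by linarith
      qed
    qed
    define r where "r = s / (s - 1)"
    have r: "1 < r" "1 / s + 1 / r = 1" using pqs(3) by (auto simp: r_def field_simps)
    define p' where "p' = p / (p - 1)"
    have p': "1 < p'" "1 / p' + 1 / p = 1" using pqs(1) by (auto simp: p'_def field_simps)
    obtain h where h: "Lp_mem r h" "nrm r h = 1" "(LINT x|lborel. g x * h x) = of_real (nrm s g)"
      using Lp_dual_function[OF pqs(3) r g] Mg M0 by auto
    define w where "w = conv (\<lambda>z. k (- z)) h"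
    have k': "Lp_mem q (\<lambda>z. k (- z))" using Lp_reflect(1)[OF k, of 0] by simp
    \<comment> \<open>The adjoint maps the dual of the target, with exponent \<open>r\<close>, into
      the dual of the domain, with exponent \<open>p'\<close>; its exponents again satisfy Young's
      relation.\<close>
    have e': "1 / r + 1 / q = 1 + 1 / p'" using pqs(4) r(2) p'(2) by linarith
    have mw: "Lp_mem p' w" unfolding w_def by (rule Young(2)[OF r(1) pqs(2) p'(1) e' k' h(1)])
    have duality: "(LINT x|lborel. conv k F x * h x) = (LINT x|lborel. w x * F x)" if "Lp_mem p F" for F
      unfolding w_def by (rule conv_duality[OF pqs r k that h(1)])
    \<comment> \<open>Pairing \<open>g\<close> with \<open>h\<close> differs from pairing the images
      with \<open>h\<close> by a vanishing error, and the latter equals the pairing of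
      \<open>w\<close> with the unit functions \<open>f (\<sigma> n)\<close>.\<close>
    have "nrm s g \<le> nrm p' w"
    proof (rule LIMSEQ_le_const)
      show "(\<lambda>n. nrm p' w + nrm s (\<lambda>x. conv k (f (\<sigma> n)) x - g x)) \<longlonglongrightarrow> nrm p' w"
        using tendsto_add[OF tendsto_const lim, of "nrm p' w"] by simp
      show "\<exists>N. \<forall>n\<ge>N. nrm s g \<le> nrm p' w + nrm s (\<lambda>x. conv k (f (\<sigma> n)) x - g x)"
      proof (intro exI[of _ 0] allI impI)
        fix n
        let ?v = "conv k (f (\<sigma> n))"
        have "(LINT x|lborel. ?v x * h x) = (LINT x|lborel. g x * h x) + (LINT x|lborel. (?v x - g x) * h x)"
          by (subst Bochner_Integration.integral_add[symmetric])
            (use Holder(1)[OF pqs(3) r g h(1)] Holder(1)[OF pqs(3) r Lp_mem_diff[OF s0 mv g] h(1), of "\<sigma> n"] in \<open>auto simp: algebra_simps\<close>)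
        then have "complex_of_real (nrm s g) = (LINT x|lborel. w x * f (\<sigma> n) x) - (LINT x|lborel. (?v x - g x) * h x)"
          by (simp add: h(3) duality[OF f])
        then have "norm (complex_of_real (nrm s g)) \<le> norm (LINT x|lborel. w x * f (\<sigma> n) x) + norm (LINT x|lborel. (?v x - g x) * h x)"
          by (simp only: norm_triangle_ineq4)
        then show "nrm s g \<le> nrm p' w + nrm s (\<lambda>x. ?v x - g x)"
          using Holder(3)[OF p'(1) pqs(1) p'(2) mw f[of "\<sigma> n"]] Holder(3)[OF pqs(3) r Lp_mem_diff[OF s0 mv g] h(1), of "\<sigma> n"]
          by (simp add: f1 h(2))
      qed
    qed
    then have Mw: "M \<le> nrm p' w" using Mg by simp
    \<comment> \<open>\<open>F\<close> attains the norm of \<open>w\<close>; by duality the same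
      number is the pairing of the image of \<open>F\<close> with the unit function
      \<open>h\<close>, so Hoelder bounds it by the norm of that image.\<close>
    obtain F where F: "Lp_mem p F" "nrm p F = 1" "(LINT x|lborel. w x * F x) = of_real (nrm p' w)"
      using Lp_dual_function[OF p'(1) pqs(1) p'(2) mw] Mw M0 by auto
    have "nrm p' w = norm (LINT x|lborel. conv k F x * h x)"
      by (simp add: duality[OF F(1)] F(3))
    also have "\<dots> \<le> nrm s (conv k F)"
      using Holder(3)[OF pqs(3) r Young(2)[OF pqs k F(1)] h(1)] h(2) by simp
    finally have "M \<le> nrm s (conv k F)" using Mw by simp
    then show thesis using that[OF F(1,2)] M by (meson order_trans)
  qed
qed

section \<open>Lebesgue measurable functions\<close>

lemma Lp_norm_cong_AE:
  assumes "AE x in lborel. f x = g x"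
  shows "Lp_norm p f = Lp_norm p g"
proof -
  have "(\<integral>\<^sup>+ x. ennreal (norm (f x) powr p) \<partial>lborel) = (\<integral>\<^sup>+ x. ennreal (norm (g x) powr p) \<partial>lborel)"
    by (rule nn_integral_cong_AE) (use assms in eventually_elim, simp)
  then show ?thesis by (simp add: Lp_norm_def nn_integral_completion)
qed

lemma Lp_norm_eq_nrm:
  assumes "Lp_mem p f"
  shows "Lp_norm p f = ennreal (nrm p f)"
proof -
  have "0 \<le> (LINT x|lborel. norm (f x) powr p)" by (rule Bochner_Integration.integral_nonneg) simp
  then show ?thesis
    by (simp add: Lp_norm_def nn_integral_completion nn_integral_eq_integral[OF Lp_mem_integrable[OF assms]] nrm_def)
qed

lemma Lp_mem_imp_Lp_space: "Lp_mem p f \<Longrightarrow> f \<in> Lp_space p"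
  by (simp add: Lp_space_def Lp_norm_eq_nrm measurable_completion Lp_mem_measurable)

lemma Lp_space_borel_version:
  assumes "f \<in> Lp_space p"
  obtains f' where "Lp_mem p f'" "AE x in lborel. f x = f' x"
proof -
  have [measurable]: "f \<in> borel_measurable lebesgue" using assms by (simp add: Lp_space_def)
  have Re: "(\<lambda>x. Re (f x)) \<in> borel_measurable lebesgue" and Im: "(\<lambda>x. Im (f x)) \<in> borel_measurable lebesgue" by measurable
  obtain u v where [measurable]: "u \<in> borel_measurable lborel" "v \<in> borel_measurable lborel"
    and uv: "AE x in lborel. Re (f x) = u x" "AE x in lborel. Im (f x) = v x"
    using completion_ex_borel_measurable_real[OF Re] completion_ex_borel_measurable_real[OF Im] by blast
  define f' where "f' x = Complex (u x) (v x)" for x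
  have "f' x = of_real (u x) + \<i> * of_real (v x)" for x by (simp add: f'_def complex_eq_iff)
  then have [measurable]: "f' \<in> borel_measurable borel" by (subst measurable_cong) auto
  have ae: "AE x in lborel. f x = f' x"
    using uv by eventually_elim (simp add: f'_def complex_eq_iff)
  have "Lp_norm p f' < \<infinity>"
    using assms Lp_norm_cong_AE[OF ae, of p] by (simp add: Lp_space_def)
  then have "(\<integral>\<^sup>+ x. ennreal (norm (f' x) powr p) \<partial>lborel) \<noteq> \<infinity>"
    by (auto simp: Lp_norm_def Let_def nn_integral_completion)
  then have "integrable lborel (\<lambda>x. norm (f' x) powr p)"
    by (intro integrableI_nonneg) (auto simp: less_top)
  then have "Lp_mem p f'" by (simp add: Lp_mem_def)
  then show thesis using ae by (rule that)
qed

text \<open>Equality holds at every \<open>x\<close>: reflection about \<open>x\<close> preserves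
  null sets, so for each fixed \<open>x\<close> the integrands agree for almost all
  \<open>y\<close>.\<close>

lemma convolve_eq_conv:
  assumes k: "AE x in lborel. k x = k' x" and f: "AE x in lborel. f x = f' x"
    and [measurable]: "k' \<in> borel_measurable borel" "f' \<in> borel_measurable borel"
  shows "convolve k f x = conv k' f' x"
proof -
  have "AE y in lborel. k (x - y) = k' (x - y)" using AE_reflect[of x, OF _ k] by simp
  with f have "AE y in lborel. k' (x - y) * f' y = k (x - y) * f y" by eventually_elim simp
  then have ae: "AE y in lebesgue. k' (x - y) * f' y = k (x - y) * f y" by (rule AE_completion)
  have m: "(\<lambda>y. k' (x - y) * f' y) \<in> borel_measurable lborel" by measurable
  then have "(\<lambda>y. k' (x - y) * f' y) \<in> borel_measurable lebesgue" by (rule measurable_completion)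
  then have "convolve k f x = (\<integral>y. k' (x - y) * f' y \<partial>lebesgue)"
    unfolding convolve_def
    by (intro integral_cong_AE borel_measurable_AE[OF _ ae]) (use ae in auto)
  also have "\<dots> = conv k' f' x" unfolding conv_def by (rule integral_completion[OF m])
  finally show ?thesis .
qed

theorem theorem1:
  fixes p q r :: real and k :: "real ^ 'n \<Rightarrow> complex"
  assumes "1 < p" and "1 < q" and "1 < r"
    and "1 / p + 1 / q + 1 / r = 2"
    and "k \<in> Lp_space q"
  shows "\<exists>f. is_maximizer p r (convolve k) f"
proof -
  define s where "s = conj_exponent r"
  have s: "1 < s" "1 / s = 1 - 1 / r"
    using assms(3) by (auto simp: s_def conj_exponent_def field_simps)
  \<comment> \<open>With \<open>s\<close> the conjugate of \<open>r\<close>, the symmetric condition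
    on the exponents becomes Young's relation.\<close>
  have pqs: "1 / p + 1 / q = 1 + 1 / s" using assms(4) s by simp
  obtain k' where k': "Lp_mem q k'" and kk': "AE x in lborel. k x = k' x"
    using Lp_space_borel_version[OF assms(5)] by blast
  obtain f where f: "Lp_mem p f" "nrm p f = 1"
    and max: "\<And>g. Lp_mem p g \<Longrightarrow> nrm p g = 1 \<Longrightarrow> nrm s (conv k' g) \<le> nrm s (conv k' f)"
    using conv_maximizer[OF assms(1,2) s(1) pqs k'] by blast
  have norm_conv: "Lp_norm s (convolve k g) = ennreal (nrm s (conv k' g'))"
    if "Lp_mem p g'" "AE x in lborel. g x = g' x" for g g'
  proof -
    have "convolve k g = conv k' g'"
      using convolve_eq_conv[OF kk' that(2) Lp_mem_measurable[OF k'] Lp_mem_measurable[OF that(1)]] by auto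
    then show ?thesis
      using Lp_norm_eq_nrm[OF Young(2)[OF assms(1,2) s(1) pqs k' that(1)]] by simp
  qed
  have "is_maximizer p r (convolve k) f"
    unfolding is_maximizer_def op_norm_def s_def[symmetric]
  proof (intro conjI)
    show space: "f \<in> Lp_space p" and one: "Lp_norm p f = 1"
      using f by (simp_all add: Lp_mem_imp_Lp_space Lp_norm_eq_nrm)
    show "Lp_norm s (convolve k f) = (SUP f\<in>{f \<in> Lp_space p. Lp_norm p f = 1}. Lp_norm s (convolve k f))"
    proof (rule antisym)
      show "Lp_norm s (convolve k f) \<le> (SUP f\<in>{f \<in> Lp_space p. Lp_norm p f = 1}. Lp_norm s (convolve k f))"
        by (rule SUP_upper) (use space one in simp)
      show "(SUP f\<in>{f \<in> Lp_space p. Lp_norm p f = 1}. Lp_norm s (convolve k f)) \<le> Lp_norm s (convolve k f)"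
      proof (rule SUP_least, clarify)
        fix g :: "real ^ 'n \<Rightarrow> complex" assume g: "g \<in> Lp_space p" "Lp_norm p g = 1"
        \<comment> \<open>A Lebesgue measurable competitor has a Borel version with the same norm
          and, at every point, the same convolution, so maximality among Borel functions
          suffices.\<close>
        obtain g' where g': "Lp_mem p g'" "AE x in lborel. g x = g' x"
          using Lp_space_borel_version[OF g(1)] by blast
        have "nrm p g' = 1"
          using g(2) Lp_norm_cong_AE[OF g'(2), of p] Lp_norm_eq_nrm[OF g'(1)] by simp
        then show "Lp_norm s (convolve k g) \<le> Lp_norm s (convolve k f)"
          using max[OF g'(1)] by (simp add: norm_conv[OF g'] norm_conv[OF f(1)] ennreal_leI)
      qed
    qed
  qed
  then show ?thesis by blast
qed

end
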